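(* Let $d\ge1$ be an integer and $\lambda\in(0,1)$. Then for every $C>0$ there is a constant $N=N(d,\lambda,C)$ such that the following hold for all pairs of integers $(a,b)$ with $a,b\ge N$ and $a/(a+b)\in(\lambda-\tfrac1N,\lambda+\tfrac1N)$, where \[ \mathcal W_{a,b}:=\big\{m\in\{0,\dots,ab\}:\ |m-\mu_{a,b}|\le C\,\sigma_{a,b}\big\}. \] (1) For every $m\in\mathcal W_{a,b}$, the normalized Jensen polynomial $\mathcal J^{d,m}_{a,b}(X)$ is hyperbolic (all of its zeros are real). (2) For every $1\le r\le d$ and every $k\in\mathcal W_{a,b}$, one has \[ (\mathcal L^{\,r}c_{a,b})(k)\ \ge\ 0 . \]
   Context: For positive integers $a,b$, the Gaussian ($q$-binomial) coefficient is the polynomial \[ \genfrac{[}{]}{0pt}{}{a+b}{a}_q=\frac{(q;q)_{a+b}}{(q;q)_a(q;q)_b}=\sum_{k=0}^{ab}c_{a,b}(k)\,q^k,\qquad (q;q)_n:=\prod_{j=1}^{n}(1-q^j),\ (q;q)_0:=1. \] Put $p_{a,b}(k):=c_{a,b}(k)/\binom{a+b}{a}$ (with $c_{a,b}(k)=0$ for $k\notin\{0,\dots,ab\}$), and \[ \mu_{a,b}:=\frac{ab}{2},\qquad \sigma_{a,b}^2:=\frac{ab(a+b+1)}{12}\ (\sigma_{a,b}>0),\qquad \delta_{a,b}:=\frac{1}{\sqrt2\,\sigma_{a,b}}. \] For a sequence $u=(u_k)_{k\in\mathbb Z}$ and integers $m\in\mathbb{Z}$, $d\ge0$, the degree $d$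 index $m$ Jensen polynomial is $J^{d,m}(X;u):=\sum_{j=0}^{d}\binom dj u_{m+j}X^j$. The normalized Jensen polynomials are \[ \mathcal J^{d,m}_{a,b}(X):=\frac{\delta_{a,b}^{-d}}{p_{a,b}(m)}\,J^{d,m}\big(\delta_{a,b}X-1;\,p_{a,b}\big). \] For a finite sequence $u=(u_k)_{k=0}^{N'}$, with the convention $u_{-1}=u_{N'+1}=0$, the operator $\mathcal L$ is $(\mathcal Lu)_k:=u_k^2-u_{k-1}u_{k+1}$, and $\mathcal L^r$ denotes its $r$-fold iterate. Here $\mathcal L^r$ is applied to the sequence $(c_{a,b}(k))_{k=0}^{ab}$, and $(\mathcal L^rc_{a,b})(k)$ is the $k$-th term of the result. *)

theory Defs
  imports Complex_Main "HOL-Computational_Algebra.Polynomial"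
begin

definition qpoch :: "nat \<Rightarrow> real poly" where
  "qpoch n = (\<Prod>j=1..n. 1 - monom 1 j)"

text \<open>The denominator divides the numerator, so the Euclidean quotient below is the exact one.\<close>

definition gauss_poly :: "nat \<Rightarrow> nat \<Rightarrow> real poly" where
  "gauss_poly a b = qpoch (a + b) div (qpoch a * qpoch b)"

definition gauss_coeff :: "nat \<Rightarrow> nat \<Rightarrow> int \<Rightarrow> real" where
  "gauss_coeff a b k = (if 0 \<le> k \<and> k \<le> int (a * b) then coeff (gauss_poly a b) (nat k) else 0)"

definition gauss_prob :: "nat \<Rightarrow> nat \<Rightarrow> int \<Rightarrow> real" where
  "gauss_prob a b k = gauss_coeff a b k / real ((a + b) choose a)"

definition gauss_mean :: "nat \<Rightarrow> nat \<Rightarrow> real" where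
  "gauss_mean a b = real a * real b / 2"

definition gauss_sd :: "nat \<Rightarrow> nat \<Rightarrow> real" where
  "gauss_sd a b = sqrt (real a * real b * (real a + real b + 1) / 12)"

definition gauss_delta :: "nat \<Rightarrow> nat \<Rightarrow> real" where
  "gauss_delta a b = 1 / (sqrt 2 * gauss_sd a b)"

definition jensen_poly :: "nat \<Rightarrow> int \<Rightarrow> (int \<Rightarrow> real) \<Rightarrow> real poly" where
  "jensen_poly d m u = (\<Sum>j=0..d. monom (real (d choose j) * u (m + int j)) j)"

definition normalized_jensen :: "nat \<Rightarrow> int \<Rightarrow> nat \<Rightarrow> nat \<Rightarrow> real poly" where
  "normalized_jensen d m a b =
     smult (inverse (gauss_delta a b ^ d) / gauss_prob a b m)
       (pcompose (jensen_poly d m (gauss_prob a b)) [:-1, gauss_delta a b:])"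

text \<open>Under this definition the zero polynomial is not hyperbolic.\<close>

definition hyperbolic :: "real poly \<Rightarrow> bool" where
  "hyperbolic f \<longleftrightarrow> (\<forall>z::complex. poly (map_poly complex_of_real f) z = 0 \<longrightarrow> z \<in> \<real>)"

text \<open>
  A finite sequence \<open>u\<^sub>0, \<dots>, u\<^sub>n\<close> is represented by a function on the integers of which only
  the values on \<open>{0..n}\<close> matter: \<open>zero_ext n\<close> replaces all other values by 0.
\<close>

definition zero_ext :: "nat \<Rightarrow> (int \<Rightarrow> real) \<Rightarrow> int \<Rightarrow> real" where
  "zero_ext n u k = (if 0 \<le> k \<and> k \<le> int n then u k else 0)"

definition L_op :: "nat \<Rightarrow> (int \<Rightarrow> real) \<Rightarrow> int \<Rightarrow> real" where
  "L_op n u k = (zero_ext n u k)\<^sup>2 - zero_ext n u (k - 1) * zero_ext n u (k + 1)"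

definition gauss_window :: "real \<Rightarrow> nat \<Rightarrow> nat \<Rightarrow> int set" where
  "gauss_window C a b =
     {m. 0 \<le> m \<and> m \<le> int (a * b) \<and> \<bar>real_of_int m - gauss_mean a b\<bar> \<le> C * gauss_sd a b}"

end

theory Submission
  imports
    Defs
    "HOL-Probability.Probability"
    "HOL-Computational_Algebra.Polynomial_FPS"
    "HOL-Real_Asymp.Real_Asymp"
begin

text \<open>
  The core is a local limit theorem for all finite differences of \<open>k \<mapsto> gauss_prob a b k\<close>: after
  scaling by powers of the standard deviation \<open>\<sigma>\<close> they converge to the derivatives of the normal
  density. It follows by Fourier inversion and dominated convergence from bounds on the Gaussian
  polynomial at \<open>q = cis (2 \<theta>)\<close>, with \<open>n = a + b\<close>. For \<open>n \<bar>\<theta>\<bar> \<le> \<pi>\<close> it is a product of quotients of sines,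
  and \<open>sin x / x * exp (x\<^sup>2 / 6)\<close> is decreasing. For larger \<open>\<theta>\<close> one cuts the \<open>n\<close> factors of
  \<open>\<Prod>i<n. 1 + q^i X\<close> into blocks of a length \<open>k\<close> with \<open>k \<bar>\<theta>\<bar> \<le> \<pi>\<close>; the first bound applies to each
  block, and \<open>X = a / b\<close> loses only a factor \<open>n + 1\<close> in the extraction of the coefficient of \<open>X^a\<close>.

  Along a sequence of pairs \<open>(a, b)\<close> and points \<open>m\<close> with \<open>(m - \<mu>) / \<sigma> \<longlonglongrightarrow> x\<close>, the normalized Jensen
  polynomials therefore tend to a translate of a Hermite polynomial, whose roots are real and simple,
  and the scaled iterates of \<open>\<L>\<close> tend to the iterates of \<open>f \<mapsto> f'\<^sup>2 - f f''\<close> at \<open>x\<close>, which map a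
  Gaussian to a positive multiple of its square. Compactness of \<open>[-C, C]\<close> makes this uniform.
\<close>

section \<open>The Gaussian polynomial at complex numbers\<close>

text \<open>The tail estimate has to beat every power of \<open>n\<close>, because the
  \<open>j\<close>-th difference is scaled by \<open>\<sigma> ^ (j + 1)\<close> with
  \<open>\<sigma>\<close> of order \<open>n\<close> to the 3/2, while the sine quotients are under
  control only up to \<open>\<bar>\<theta>\<bar> = pi / n\<close>. A block of length
  \<open>k\<close> gains a constant factor as soon as \<open>k ^ 3 * \<theta>\<^sup>2\<close> is
  bounded below, which at \<open>\<theta> = pi / n\<close> asks for \<open>k\<close> about
  \<open>n\<close> to the 2/3. About \<open>n\<close> to the 1/3 such blocks fit, and a constant
  below 1 raised to that power beats every polynomial in \<open>n\<close>, including the factor lost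
  in the extraction of the coefficient. The gain per block is uniform only if
  \<open>a / (a + b)\<close> stays away from 0 and 1: the extreme coefficients of a block have
  modulus 1, so the weights \<open>X ^ j\<close> must not concentrate on them. Limits of differences
  are taken at a moving point \<open>m\<close>, so the limit function enters only through its Taylor
  coefficients; it is handled as a formal power series.\<close>

lemma poly_eq_sum_atMost:
  fixes p :: "'a :: comm_semiring_1 poly"
  assumes "degree p \<le> n"
  shows "poly p x = (\<Sum>i\<le>n. coeff p i * x ^ i)"
  unfolding poly_altdef
  using assms by (intro sum.mono_neutral_left) (auto simp: coeff_eq_0)

text \<open>The q-Pascal rule, a division-free form of the quotient in \<open>gauss_poly\<close>.
  The inductions on \<open>a\<close> and \<open>b\<close> below follow this recursion.\<close>

fun qbin :: "nat \<Rightarrow> nat \<Rightarrow> real poly" where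
  "qbin 0 b = 1"
| "qbin (Suc a) 0 = 1"
| "qbin (Suc a) (Suc b) = qbin (Suc a) b + monom 1 (Suc b) * qbin a (Suc b)"

lemma qbin_0_right [simp]: "qbin a 0 = 1"
  by (cases a) auto

lemma qpoch_0 [simp]: "qpoch 0 = 1"
  by (simp add: qpoch_def)

lemma qpoch_Suc: "qpoch (Suc n) = qpoch n * (1 - monom 1 (Suc n))"
  by (simp add: qpoch_def)

lemma qpoch_nonzero: "qpoch n \<noteq> 0"
proof -
  have "1 - monom 1 j \<noteq> (0::real poly)" if "j \<ge> 1" for j
  proof
    assume "1 - monom 1 j = (0::real poly)"
    then have "coeff (1 - monom 1 j :: real poly) j = 0" by simp
    with that show False by auto
  qed
  then show ?thesis by (auto simp: qpoch_def)
qed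

lemma qbin_mult_qpoch: "qbin a b * (qpoch a * qpoch b) = qpoch (a + b)"
proof (induction a b rule: qbin.induct)
  case (3 a b)
  have e: "monom 1 (Suc (a + Suc b)) = monom 1 (Suc a) * monom (1::real) (Suc b)"
    by (simp add: mult_monom)
  have "qbin (Suc a) (Suc b) * (qpoch (Suc a) * qpoch (Suc b)) =
     (qbin (Suc a) b * (qpoch (Suc a) * qpoch b)) * (1 - monom 1 (Suc b))
     + monom 1 (Suc b) * (1 - monom 1 (Suc a)) * (qbin a (Suc b) * (qpoch a * qpoch (Suc b)))"
    by (simp add: qpoch_Suc algebra_simps)
  also have "\<dots> = qpoch (a + Suc b) * (1 - monom 1 (Suc (a + Suc b)))"
    unfolding 3 e by (simp add: algebra_simps)
  finally show ?case by (simp add: qpoch_Suc)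
qed (auto simp: qpoch_Suc)

lemma gauss_poly_eq_qbin: "gauss_poly a b = qbin a b"
  using nonzero_mult_div_cancel_right[of "qpoch a * qpoch b" "qbin a b"]
  by (simp add: gauss_poly_def qbin_mult_qpoch qpoch_nonzero)

lemma degree_qbin: "degree (qbin a b) \<le> a * b"
proof (induction a b rule: qbin.induct)
  case (3 a b)
  have "degree (monom 1 (Suc b) * qbin a (Suc b)) \<le> Suc b + a * Suc b"
    using 3(2) by (intro order.trans[OF degree_mult_le] add_mono) (auto simp: degree_monom_eq)
  moreover have "Suc a * b \<le> Suc b + a * Suc b" by simp
  ultimately show ?case using 3(1)
    by (auto intro!: degree_add_le)
qed auto

lemma poly_qbin_1: "poly (qbin a b) 1 = real ((a + b) choose a)"
  by (induction a b rule: qbin.induct) (auto simp: poly_monom)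

abbreviation cpoly :: "real poly \<Rightarrow> complex poly" where
  "cpoly \<equiv> map_poly complex_of_real"

lemma cpoly_add: "cpoly (p + q) = cpoly p + cpoly q"
  by (intro poly_eqI) (simp add: coeff_map_poly)

lemma cpoly_mult: "cpoly (p * q) = cpoly p * cpoly q"
  by (intro poly_eqI) (simp add: coeff_map_poly coeff_mult)

lemma cpoly_monom: "cpoly (monom c n) = monom (of_real c) n"
  by (intro poly_eqI) (simp add: coeff_map_poly)

lemma cpoly_1: "cpoly 1 = 1"
  by (simp add: map_poly_1)

definition qval :: "nat \<Rightarrow> nat \<Rightarrow> complex \<Rightarrow> complex" where
  "qval a b q = poly (cpoly (qbin a b)) q"

lemma qval_0 [simp]: "qval 0 b q = 1" "qval a 0 q = 1"
  by (simp_all add: qval_def cpoly_1)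

lemma qval_Suc: "qval (Suc a) (Suc b) q = qval (Suc a) b q + q ^ Suc b * qval a (Suc b) q"
  by (simp add: qval_def cpoly_add cpoly_mult cpoly_monom poly_monom)

lemma qval_eq_sum: "qval a b q = (\<Sum>k\<le>a*b. of_real (coeff (qbin a b) k) * q ^ k)"
proof -
  have "degree (cpoly (qbin a b)) \<le> a * b"
    using degree_qbin by (subst degree_map_poly) auto
  then show ?thesis unfolding qval_def
    by (subst poly_eq_sum_atMost) (auto simp: coeff_map_poly)
qed

text \<open>Kept in product form because the factors \<open>1 - q ^ i\<close> may vanish when
  \<open>q\<close> is a root of unity.\<close>

lemma qval_mult_qpoch:
  "qval a b q * ((\<Prod>i=1..a. 1 - q ^ i) * (\<Prod>i=1..b. 1 - q ^ i)) = (\<Prod>i=1..a+b. 1 - q ^ i)"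
proof (induction a b rule: qbin.induct)
  case (3 a b)
  have e: "q ^ Suc (a + Suc b) = q ^ Suc a * q ^ Suc b"
    by (simp add: power_add)
  have "qval (Suc a) (Suc b) q * ((\<Prod>i=1..Suc a. 1 - q ^ i) * (\<Prod>i=1..Suc b. 1 - q ^ i)) =
     (qval (Suc a) b q * ((\<Prod>i=1..Suc a. 1 - q ^ i) * (\<Prod>i=1..b. 1 - q ^ i))) * (1 - q ^ Suc b)
     + q ^ Suc b * (1 - q ^ Suc a) * (qval a (Suc b) q * ((\<Prod>i=1..a. 1 - q ^ i) * (\<Prod>i=1..Suc b. 1 - q ^ i)))"
    by (simp add: qval_Suc algebra_simps)
  also have "\<dots> = (\<Prod>i=1..a + Suc b. 1 - q ^ i) * (1 - q ^ Suc (a + Suc b))"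
    unfolding 3 e by (simp add: algebra_simps)
  finally show ?case by simp
qed auto

section \<open>The product of the factors \<open>1 + q ^ i X\<close> and the moduli of its
  coefficients\<close>

definition qrow :: "complex \<Rightarrow> nat \<Rightarrow> complex poly" where
  "qrow q n = (\<Prod>i<n. [:1, q ^ i:])"

lemma qrow_Suc: "qrow q (Suc n) = qrow q n * [:1, q ^ n:]"
  by (simp add: qrow_def)

lemma coeff_qrow_Suc: "coeff (qrow q (Suc n)) 0 = coeff (qrow q n) 0"
  "coeff (qrow q (Suc n)) (Suc j) = coeff (qrow q n) (Suc j) + q ^ n * coeff (qrow q n) j"
  by (simp_all add: qrow_Suc mult.commute[of _ "[:_, _:]"])

lemma degree_qrow: "degree (qrow q n) \<le> n"
proof (induction n)
  case (Suc n)
  have "degree (qrow q (Suc n)) \<le> degree (qrow q n) + degree [:1, q ^ n:]"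
    unfolding qrow_Suc by (rule degree_mult_le)
  also have "\<dots> \<le> n + 1" using Suc by (intro add_mono) auto
  finally show ?case by simp
qed (simp add: qrow_def)

text \<open>The q-binomial theorem. Splitting off the last factor \<open>1 + q ^ n X\<close> gives
  the coefficients the same Pascal rule as \<open>qval\<close>, up to the power of
  \<open>q\<close>.\<close>

lemma coeff_qrow: "coeff (qrow q (a + b)) a = q ^ (a * (a - 1) div 2) * qval a b q"
proof (induction a b rule: qbin.induct)
  case (1 b)
  then show ?case by (induction b) (auto simp: coeff_qrow_Suc, simp add: qrow_def)
next
  case (2 a)
  have "coeff (qrow q n) n = q ^ (n * (n - 1) div 2)" for n
  proof (induction n)
    case (Suc n)
    have "Suc n * n div 2 = n * (n - 1) div 2 + n"
      by (cases n) auto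
    with Suc degree_qrow[of q n] show ?case
      by (simp add: coeff_qrow_Suc power_add coeff_eq_0 del: mult_Suc)
  qed (simp add: qrow_def)
  then show ?case by simp
next
  case (3 a b)
  have "Suc a * a div 2 = a * (a - 1) div 2 + a"
    by (cases a) auto
  with 3 show ?case
    by (simp add: coeff_qrow_Suc qval_Suc power_add algebra_simps del: mult_Suc)
qed

text \<open>A weighted l1 norm of the coefficients, written as the value of a polynomial so that a
  product of norms is the value of a product of polynomials.\<close>

definition coeff_norm :: "real \<Rightarrow> complex poly \<Rightarrow> real" where
  "coeff_norm X p = poly (map_poly norm p) X"

lemma coeff_norm_eq_sum:
  assumes "degree p \<le> n"
  shows "coeff_norm X p = (\<Sum>j\<le>n. norm (coeff p j) * X ^ j)"
proof -
  have "degree (map_poly norm p) \<le> n"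
    using assms by (subst degree_map_poly) auto
  then show ?thesis unfolding coeff_norm_def
    by (subst poly_eq_sum_atMost) (auto simp: coeff_map_poly)
qed

lemma coeff_norm_nonneg: "X \<ge> 0 \<Longrightarrow> coeff_norm X p \<ge> 0"
  by (simp add: coeff_norm_eq_sum[OF order.refl] sum_nonneg)

lemma coeff_norm_ge_coeff:
  assumes "X \<ge> 0"
  shows "norm (coeff p j) * X ^ j \<le> coeff_norm X p"
proof -
  have "norm (coeff p j) * X ^ j \<le> (\<Sum>j\<le>max j (degree p). norm (coeff p j) * X ^ j)"
    using assms by (intro member_le_sum) auto
  then show ?thesis by (simp add: coeff_norm_eq_sum[of p "max j (degree p)"])
qed

lemma coeff_norm_mult_le:
  assumes "X \<ge> 0"
  shows "coeff_norm X (p * q) \<le> coeff_norm X p * coeff_norm X q"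
proof -
  let ?a = "map_poly norm p" and ?b = "map_poly norm q"
  define n where "n = max (degree (p * q)) (degree (?a * ?b))"
  have "coeff_norm X (p * q) = (\<Sum>j\<le>n. norm (coeff (p * q) j) * X ^ j)"
    by (rule coeff_norm_eq_sum) (simp add: n_def)
  also have "\<dots> \<le> (\<Sum>j\<le>n. coeff (?a * ?b) j * X ^ j)"
  proof (intro sum_mono mult_right_mono)
    fix j
    show "norm (coeff (p * q) j) \<le> coeff (?a * ?b) j"
      unfolding coeff_mult by (rule order.trans[OF norm_sum]) (simp add: coeff_map_poly norm_mult)
  qed (use assms in auto)
  also have "\<dots> = poly (?a * ?b) X"
    by (subst poly_eq_sum_atMost[of _ n]) (auto simp: n_def)
  finally show ?thesis by (simp add: coeff_norm_def)
qed

text \<open>The last \<open>n\<close> factors are those of \<open>qrow q n\<close> with the variable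
  multiplied by \<open>q ^ m\<close>; as this number has modulus 1, the moduli of the coefficients
  do not change.\<close>

lemma coeff_norm_qrow_add_le:
  assumes "X \<ge> 0" "norm q = 1"
  shows "coeff_norm X (qrow q (m + n)) \<le> coeff_norm X (qrow q m) * coeff_norm X (qrow q n)"
proof -
  have "qrow q (m + n) = qrow q m * pcompose (qrow q n) [:0, q ^ m:]" for n
  proof (induction n)
    case (Suc n)
    have "pcompose [:1, q ^ n:] [:0, q ^ m:] = [:1, q ^ (m + n):]"
      by (simp add: pcompose_pCons power_add mult.commute)
    then show ?case
      using Suc by (simp only: add_Suc_right qrow_Suc pcompose_mult mult.assoc)
  qed (simp add: qrow_def pcompose_1)
  moreover have "coeff_norm X (pcompose p [:0, c:]) = coeff_norm X p" if "norm c = 1" for p c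
  proof -
    have "map_poly norm (pcompose p [:0, c:]) = map_poly norm p"
      using that by (intro poly_eqI) (simp add: coeff_map_poly coeff_pcompose_linear norm_mult norm_power)
    then show ?thesis by (simp add: coeff_norm_def)
  qed
  ultimately show ?thesis
    using coeff_norm_mult_le[OF assms(1)] assms(2) by (metis norm_power power_one)
qed

lemma coeff_norm_qrow_le:
  assumes "X \<ge> 0" "norm q = 1"
  shows "coeff_norm X (qrow q n) \<le> (1 + X) ^ n"
proof (induction n)
  case (Suc n)
  have "coeff_norm X (qrow q (Suc n)) \<le> coeff_norm X (qrow q n) * coeff_norm X [:1, q ^ n:]"
    unfolding qrow_Suc by (rule coeff_norm_mult_le[OF assms(1)])
  also have "coeff_norm X [:1, q ^ n:] = 1 + X"
    using assms by (subst coeff_norm_eq_sum[of _ 1]) (auto simp: norm_power)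
  also have "coeff_norm X (qrow q n) * (1 + X) \<le> (1 + X) ^ n * (1 + X)"
    using assms by (intro mult_right_mono Suc) auto
  finally show ?case by (simp add: mult.commute)
qed (simp add: qrow_def coeff_norm_def map_poly_1)

lemma coeff_norm_qrow_mult_le:
  assumes "X \<ge> 0" "norm q = 1"
  shows "coeff_norm X (qrow q (r * k + l)) \<le> coeff_norm X (qrow q k) ^ r * (1 + X) ^ l"
proof (induction r)
  case (Suc r)
  have "coeff_norm X (qrow q (k + (r * k + l))) \<le> coeff_norm X (qrow q k) * coeff_norm X (qrow q (r * k + l))"
    by (rule coeff_norm_qrow_add_le[OF assms])
  also have "\<dots> \<le> coeff_norm X (qrow q k) * (coeff_norm X (qrow q k) ^ r * (1 + X) ^ l)"
    by (intro mult_left_mono Suc coeff_norm_nonneg assms)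
  finally show ?case by (simp add: algebra_simps)
qed (use coeff_norm_qrow_le[OF assms] in simp)

section \<open>Quotients of sines\<close>

lemma sin_ge_x_cos: "0 \<le> x \<Longrightarrow> x \<le> pi \<Longrightarrow> x * cos x \<le> sin (x::real)"
proof -
  assume x: "0 \<le> x" "x \<le> pi"
  have "0 - 0 * cos 0 \<le> sin x - x * cos x"
  proof (rule order.trans[OF _ DERIV_nonneg_imp_nondecreasing[OF x(1)]])
    fix y assume y: "0 \<le> y" "y \<le> x"
    show "\<exists>d. ((\<lambda>y. sin y - y * cos y) has_real_derivative d) (at y) \<and> 0 \<le> d"
      using y x by (intro exI[of _ "y * sin y"] conjI)
        (auto intro!: derivative_eq_intros mult_nonneg_nonneg sin_ge_zero)
  qed simp
  then show ?thesis by simp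
qed

text \<open>This is the sign of the logarithmic derivative of
  \<open>sin x / x * exp (x\<^sup>2 / 6)\<close>, cleared of denominators. The difference of the two
  sides has derivative \<open>x / 3 * (sin x - x * cos x)\<close>, nonnegative by
  \<open>sin_ge_x_cos\<close>.\<close>

lemma sin_cos_cubic_le: "0 \<le> x \<Longrightarrow> x \<le> pi \<Longrightarrow> x * cos x \<le> (1 - x\<^sup>2 / 3) * sin (x::real)"
proof -
  assume x: "0 \<le> x" "x \<le> pi"
  have "0 \<le> (1 - x\<^sup>2 / 3) * sin x - x * cos x"
  proof (rule order.trans[OF _ DERIV_nonneg_imp_nondecreasing[OF x(1)]])
    fix y assume y: "0 \<le> y" "y \<le> x"
    show "\<exists>d. ((\<lambda>y. (1 - y\<^sup>2 / 3) * sin y - y * cos y) has_real_derivative d) (at y) \<and> 0 \<le> d"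
    proof (intro exI[of _ "y / 3 * (sin y - y * cos y)"] conjI)
      show "0 \<le> y / 3 * (sin y - y * cos y)"
        using y x sin_ge_x_cos[of y] by (intro mult_nonneg_nonneg) auto
    qed (auto intro!: derivative_eq_intros simp: field_simps power2_eq_square)
  qed simp
  then show ?thesis by simp
qed

lemma sinc_exp_antimono:
  fixes x y :: real
  assumes "0 < x" "x \<le> y" "y \<le> pi"
  shows "sin y / y * exp (y\<^sup>2 / 6) \<le> sin x / x * exp (x\<^sup>2 / 6)"
proof (rule DERIV_nonpos_imp_nonincreasing[OF assms(2)])
  fix z assume z: "x \<le> z" "z \<le> y"
  then have z0: "0 < z" "z \<le> pi" using assms by auto
  have "((\<lambda>z. sin z / z * exp (z\<^sup>2 / 6)) has_real_derivative
      exp (z\<^sup>2 / 6) / z\<^sup>2 * (z * cos z - (1 - z\<^sup>2 / 3) * sin z)) (at z)"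
    using z0 by (auto intro!: derivative_eq_intros simp: field_simps power2_eq_square)
  moreover have "exp (z\<^sup>2 / 6) / z\<^sup>2 * (z * cos z - (1 - z\<^sup>2 / 3) * sin z) \<le> 0"
    using sin_cos_cubic_le[of z] z0 by (intro mult_nonneg_nonpos) auto
  ultimately show "\<exists>d. ((\<lambda>z. sin z / z * exp (z\<^sup>2 / 6)) has_real_derivative d) (at z) \<and> d \<le> 0"
    by blast
qed

lemma sin_ge_cubic:
  fixes x :: real
  assumes "0 \<le> x"
  shows "x - x ^ 3 / 6 \<le> sin x"
proof -
  have "0 \<le> sin x - x + x ^ 3 / 6"
  proof (rule order.trans[OF _ DERIV_nonneg_imp_nondecreasing[OF assms]])
    fix y :: real assume y: "0 \<le> y" "y \<le> x"
    have "(sin (y / 2))\<^sup>2 \<le> (y / 2)\<^sup>2"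
      using abs_sin_x_le_abs_x[of "y / 2"] by (rule iffD1[OF abs_le_square_iff])
    then have "0 \<le> cos y - 1 + y\<^sup>2 / 2"
      using cos_double_sin[of "y / 2"] by (simp add: power_divide)
    then show "\<exists>d. ((\<lambda>y. sin y - y + y ^ 3 / 6) has_real_derivative d) (at y) \<and> 0 \<le> d"
      by (intro exI[of _ "cos y - 1 + y\<^sup>2 / 2"] conjI) (auto intro!: derivative_eq_intros)
  qed simp
  then show ?thesis by simp
qed

lemma sin_ratio_le:
  fixes x y :: real
  assumes "0 < x" "x \<le> y" "y \<le> pi" "x < pi"
  shows "sin y / sin x \<le> y / x * exp (- (y\<^sup>2 - x\<^sup>2) / 6)"
proof -
  have "sin x > 0" using assms by (intro sin_gt_zero) auto
  have "sin y / sin x = (sin y / y * exp (y\<^sup>2 / 6)) * (y / sin x * exp (- y\<^sup>2 / 6))"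
    using assms by (simp add: exp_minus)
  also have "\<dots> \<le> (sin x / x * exp (x\<^sup>2 / 6)) * (y / sin x * exp (- y\<^sup>2 / 6))"
    using assms \<open>sin x > 0\<close> by (intro mult_right_mono sinc_exp_antimono) auto
  also have "\<dots> = y / x * (exp (x\<^sup>2 / 6) * exp (- y\<^sup>2 / 6))"
    using \<open>sin x > 0\<close> by simp
  also have "exp (x\<^sup>2 / 6) * exp (- y\<^sup>2 / 6) = exp (- (y\<^sup>2 - x\<^sup>2) / 6)"
    by (simp flip: exp_add add: diff_divide_distrib)
  finally show ?thesis .
qed

lemma sinc_le_exp:
  fixes x :: real
  assumes "0 < x" "x \<le> pi"
  shows "sin x / x \<le> exp (- x\<^sup>2 / 6)"
proof -
  \<comment> \<open>The decreasing function has limit 1 at 0, so 1 bounds it.\<close>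
  have "((\<lambda>x::real. sin x / x * exp (x\<^sup>2 / 6)) \<longlongrightarrow> 1 * exp (0\<^sup>2 / 6)) (at_right 0)"
    using sinc_at_0 by (intro tendsto_intros) (auto simp: filterlim_at_split)
  moreover have "\<forall>\<^sub>F z in at_right 0. sin x / x * exp (x\<^sup>2 / 6) \<le> sin z / z * exp (z\<^sup>2 / 6)"
    unfolding eventually_at_right_field
  proof (intro exI[of _ x] conjI allI impI)
    fix z assume "0 < z" "z < x"
    then show "sin x / x * exp (x\<^sup>2 / 6) \<le> sin z / z * exp (z\<^sup>2 / 6)"
      using assms by (intro sinc_exp_antimono) auto
  qed (use assms in auto)
  ultimately have "sin x / x * exp (x\<^sup>2 / 6) \<le> 1"
    using tendsto_lowerbound[of "\<lambda>x::real. sin x / x * exp (x\<^sup>2 / 6)" 1 "at_right 0"] by simp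
  then have "sin x / x \<le> inverse (exp (x\<^sup>2 / 6))"
    by (simp add: le_divide_eq flip: inverse_eq_divide) (simp add: inverse_eq_divide le_divide_eq)
  then show ?thesis by (simp flip: exp_minus)
qed

text \<open>With \<open>u = y\<^sup>2 / 6\<close> one has \<open>1 - u \<le> sin y / y\<close> and
  \<open>ln (1 - u) \<ge> - u - 2 * u\<^sup>2\<close>; the quadratic term is
  \<open>y ^ 4 / 18\<close>, rounded up to \<open>y ^ 4\<close>.\<close>

lemma sinc_ge_exp:
  fixes y :: real
  assumes "0 < y" "y \<le> 1"
  shows "exp (- y\<^sup>2 / 6 - y ^ 4) \<le> sin y / y"
proof -
  define u where "u = y\<^sup>2 / 6"
  have y2: "y\<^sup>2 \<le> 1" using assms by (simp add: power_le_one)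
  have u: "0 \<le> u" "u \<le> 1 / 2" using y2 by (auto simp: u_def)
  have "- u - 2 * u\<^sup>2 \<le> ln (1 - u)"
    using u by (rule ln_one_minus_pos_lower_bound)
  then have "exp (- u - 2 * u\<^sup>2) \<le> 1 - u"
    using u by (subst (asm) ln_ge_iff) auto
  also have "1 - u \<le> sin y / y"
  proof -
    have "y - y ^ 3 / 6 \<le> sin y"
      using sin_ge_cubic assms by simp
    then show ?thesis using assms by (simp add: u_def field_simps power2_eq_square power3_eq_cube)
  qed
  finally have "exp (- u - 2 * u\<^sup>2) \<le> sin y / y" .
  moreover have "exp (- y\<^sup>2 / 6 - y ^ 4) \<le> exp (- u - 2 * u\<^sup>2)"
    by (auto simp: u_def power_divide)
  ultimately show ?thesis by linarith
qed

text \<open>Monotonicity bounds the quotient only from above, so here the numerator is estimated by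
  \<open>sinc_ge_exp\<close> and the denominator by \<open>sinc_le_exp\<close>.\<close>

lemma sin_ratio_ge:
  fixes x y :: real
  assumes "0 < x" "x \<le> y" "y \<le> 1"
  shows "y / x * exp (- (y\<^sup>2 - x\<^sup>2) / 6 - y ^ 4) \<le> sin y / sin x"
proof -
  have pi: "1 < pi" using pi_ge_two by linarith
  have s: "sin x > 0" using assms pi by (intro sin_gt_zero) auto
  have "y / x * exp (- (y\<^sup>2 - x\<^sup>2) / 6 - y ^ 4) = exp (- y\<^sup>2 / 6 - y ^ 4) * y / (x * exp (- x\<^sup>2 / 6))"
  proof -
    have "- (y\<^sup>2 - x\<^sup>2) / 6 - y ^ 4 = (- y\<^sup>2 / 6 - y ^ 4) - (- x\<^sup>2 / 6)"
      by (simp add: diff_divide_distrib)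
    then show ?thesis by (simp only: exp_diff[of "- y\<^sup>2 / 6 - y ^ 4" "- x\<^sup>2 / 6"]) simp
  qed
  also have "\<dots> \<le> sin y / sin x"
  proof (rule frac_le)
    show "0 \<le> sin y" using assms pi by (intro sin_ge_zero) auto
    show "exp (- y\<^sup>2 / 6 - y ^ 4) * y \<le> sin y"
      using sinc_ge_exp[of y] assms by (simp add: le_divide_eq)
    show "sin x \<le> x * exp (- x\<^sup>2 / 6)"
      using sinc_le_exp[of x] assms pi by (simp add: divide_le_eq mult.commute)
  qed (use s in auto)
  finally show ?thesis .
qed

section \<open>The Gaussian polynomial on the unit circle as a product of quotients of sines\<close>

lemma one_minus_cis_pow:
  "1 - cis (2 * \<theta>) ^ i = cis (real i * \<theta>) * (- 2 * \<i>) * of_real (sin (real i * \<theta>))"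
proof -
  have "cis (2 * \<theta>) ^ i = cis (real i * \<theta>) * cis (real i * \<theta>)"
    by (simp add: Complex.DeMoivre cis_mult algebra_simps)
  moreover have "1 = cis (real i * \<theta>) * cis (- (real i * \<theta>))"
    by (simp add: cis_mult)
  moreover have "cis (- (real i * \<theta>)) - cis (real i * \<theta>) = (- 2 * \<i>) * of_real (sin (real i * \<theta>))"
    by (simp add: complex_eq_iff)
  moreover have "1 - c * c = c * ((- 2 * \<i>) * z)" if "1 = c * c'" "c' - c = (- 2 * \<i>) * z" for c c' z :: complex
    by (simp only: that(1) that(2)[symmetric] right_diff_distrib)
  ultimately show ?thesis by (simp only: mult.assoc)
qed

text \<open>By the half-angle formula \<open>one_minus_cis_pow\<close> every factor
  \<open>1 - q ^ i\<close> is a phase times a sine. The phases multiply to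
  \<open>cis (real (a * b) * \<theta>)\<close>, the sign of \<open>\<theta>\<close> cancels in each
  quotient, and the bounds on \<open>\<theta>\<close> keep the denominators nonzero.\<close>

lemma qval_cis_eq:
  fixes \<theta> :: real
  assumes "\<theta> \<noteq> 0" "real a * \<bar>\<theta>\<bar> < pi" "real b * \<bar>\<theta>\<bar> < pi"
  shows "qval a b (cis (2 * \<theta>)) =
    cis (real (a * b) * \<theta>) * of_real (\<Prod>i=1..a. sin (real (b + i) * \<bar>\<theta>\<bar>) / sin (real i * \<bar>\<theta>\<bar>))"
proof -
  define q where "q = cis (2 * \<theta>)"
  define s where "s = (\<lambda>i::nat. cis (real i * \<theta>) * (- 2 * \<i>) * of_real (sin (real i * \<theta>)))"
  have s: "1 - q ^ i = s i" for i
    unfolding q_def s_def by (rule one_minus_cis_pow)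
  have sin_nz: "sin (real i * \<bar>\<theta>\<bar>) \<noteq> 0" if "0 < i" "i \<le> a \<or> i \<le> b" for i :: nat
  proof -
    have "real i * \<bar>\<theta>\<bar> \<le> real a * \<bar>\<theta>\<bar> \<or> real i * \<bar>\<theta>\<bar> \<le> real b * \<bar>\<theta>\<bar>"
      using that by (auto intro!: mult_right_mono)
    then have "real i * \<bar>\<theta>\<bar> < pi"
      using assms by linarith
    then have "sin (real i * \<bar>\<theta>\<bar>) > 0"
      using that assms by (intro sin_gt_zero) auto
    then show ?thesis by simp
  qed
  have sin_abs: "sin (real i * \<theta>) = sgn \<theta> * sin (real i * \<bar>\<theta>\<bar>)" for i
    by (cases "\<theta> \<ge> 0") (auto simp: sgn_if)
  have s_nz: "s i \<noteq> 0" if "0 < i" "i \<le> a \<or> i \<le> b" for i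
    using sin_nz[OF that] assms(1) by (auto simp: s_def sin_abs sgn_if)
  have ratio: "s (b + i) / s i = cis (real b * \<theta>) * of_real (sin (real (b + i) * \<bar>\<theta>\<bar>) / sin (real i * \<bar>\<theta>\<bar>))"
    if "i \<in> {1..a}" for i
  proof -
    define w where "w = (\<lambda>j::nat. cis (real j * \<theta>) * (- 2 * \<i>) * of_real (sgn \<theta>))"
    have "w (b + i) = cis (real b * \<theta>) * w i"
      unfolding w_def by (simp only: of_nat_add distrib_right cis_mult[symmetric] mult.assoc)
    moreover have "s j = w j * of_real (sin (real j * \<bar>\<theta>\<bar>))" for j
      by (simp add: s_def w_def sin_abs)
    moreover have "w i \<noteq> 0"
      using assms(1) by (simp add: w_def sgn_if)
    ultimately show ?thesis
      using sin_nz[of i] that by simp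
  qed
  have "(\<Prod>i=1..a+b. s i) = (\<Prod>i=1..b. s i) * (\<Prod>i=1..a. s (b + i))"
  proof -
    have "{1..a+b} = {1..b} \<union> {b+1..b+a}" by auto
    moreover have "(\<Prod>i=b+1..b+a. s i) = (\<Prod>i=1..a. s (b + i))"
      by (rule prod.reindex_bij_witness[of _ "\<lambda>i. b + i" "\<lambda>i. i - b"]) auto
    ultimately show ?thesis by (simp add: prod.union_disjoint)
  qed
  with qval_mult_qpoch[of a b q]
  have "qval a b q * (\<Prod>i=1..a. s i) * (\<Prod>i=1..b. s i) = (\<Prod>i=1..a. s (b + i)) * (\<Prod>i=1..b. s i)"
    by (simp add: s mult_ac)
  then have "qval a b q = (\<Prod>i=1..a. s (b + i)) / (\<Prod>i=1..a. s i)"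
    using s_nz by (simp add: field_simps)
  also have "\<dots> = (\<Prod>i=1..a. cis (real b * \<theta>) * of_real (sin (real (b + i) * \<bar>\<theta>\<bar>) / sin (real i * \<bar>\<theta>\<bar>)))"
    unfolding prod_dividef[symmetric] by (intro prod.cong refl ratio)
  also have "\<dots> = cis (real (a * b) * \<theta>) * of_real (\<Prod>i=1..a. sin (real (b + i) * \<bar>\<theta>\<bar>) / sin (real i * \<bar>\<theta>\<bar>))"
    by (simp only: prod.distrib prod_constant of_real_prod) (simp add: Complex.DeMoivre mult_ac)
  finally show ?thesis by (simp add: q_def)
qed

lemma choose_eq_prod: "real ((a + b) choose a) = (\<Prod>i=1..a. real (b + i) / real i)"
proof -
  have "real ((a + b) choose a) = real (fact (a + b)) / (real (fact a) * real (fact b))"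
    by (simp add: binomial_fact)
  also have "real (fact (a + b)) = real (fact b) * (\<Prod>i=1..a. real (b + i))"
    by (induction a) (simp_all add: algebra_simps)
  finally show ?thesis
    by (simp add: prod_dividef fact_prod)
qed

text \<open>The right-hand side is 12 times the variance; this is how \<open>\<sigma>\<close> arises
  from the exponents of the sine bounds.\<close>

lemma sum_square_diff: "(\<Sum>i=1..a. (real (b + i))\<^sup>2 - (real i)\<^sup>2) = real a * real b * (real a + real b + 1)"
  by (induction a) (simp_all add: algebra_simps power2_eq_square)

text \<open>All angles lie between 0 and pi, so the quotients are nonnegative and the bounds of
  \<open>sin_ratio_le\<close> may be multiplied; \<open>sum_square_diff\<close> adds up their
  exponents.\<close>

lemma sin_prod_le:
  fixes \<theta> :: real
  assumes "\<theta> > 0" "real (a + b) * \<theta> \<le> pi" "b > 0"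
  shows "\<bar>\<Prod>i=1..a. sin (real (b + i) * \<theta>) / sin (real i * \<theta>)\<bar>
      \<le> real ((a + b) choose a) * exp (- \<theta>\<^sup>2 * (real a * real b * (real a + real b + 1)) / 6)"
proof -
  have bnd: "real (b + i) * \<theta> \<le> pi" "real i * \<theta> < pi" if "i \<in> {1..a}" for i
  proof -
    have "real (b + i) * \<theta> \<le> real (a + b) * \<theta>"
      using that assms by (intro mult_right_mono) auto
    then show "real (b + i) * \<theta> \<le> pi" using assms by linarith
    \<comment> \<open>Strict since \<open>b > 0\<close>, so no denominator vanishes even when the
      largest angle is pi.\<close>
    moreover have "real i * \<theta> < real (b + i) * \<theta>"
      using assms by (intro mult_strict_right_mono) auto
    ultimately show "real i * \<theta> < pi" by simp
  qed
  have "\<bar>\<Prod>i=1..a. sin (real (b + i) * \<theta>) / sin (real i * \<theta>)\<bar>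
      = (\<Prod>i=1..a. sin (real (b + i) * \<theta>) / sin (real i * \<theta>))"
    using bnd assms by (intro abs_of_nonneg prod_nonneg divide_nonneg_nonneg sin_ge_zero ballI)
      (auto intro: less_imp_le)
  also have "\<dots> \<le> (\<Prod>i=1..a. real (b + i) / real i * exp (- \<theta>\<^sup>2 / 6 * ((real (b + i))\<^sup>2 - (real i)\<^sup>2)))"
  proof (intro prod_mono conjI)
    fix i assume i: "i \<in> {1..a}"
    show "0 \<le> sin (real (b + i) * \<theta>) / sin (real i * \<theta>)"
      using bnd[OF i] assms by (intro divide_nonneg_nonneg sin_ge_zero) (auto intro: less_imp_le)
    have "sin (real (b + i) * \<theta>) / sin (real i * \<theta>) \<le> (real (b + i) * \<theta>) / (real i * \<theta>) *
        exp (- ((real (b + i) * \<theta>)\<^sup>2 - (real i * \<theta>)\<^sup>2) / 6)"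
      using bnd[OF i] assms i by (intro sin_ratio_le) (auto intro!: mult_right_mono)
    also have "(real (b + i) * \<theta>) / (real i * \<theta>) = real (b + i) / real i"
      using assms by simp
    also have "- ((real (b + i) * \<theta>)\<^sup>2 - (real i * \<theta>)\<^sup>2) / 6 = - \<theta>\<^sup>2 / 6 * ((real (b + i))\<^sup>2 - (real i)\<^sup>2)"
      by (simp add: field_simps power2_eq_square)
    finally show "sin (real (b + i) * \<theta>) / sin (real i * \<theta>) \<le>
      real (b + i) / real i * exp (- \<theta>\<^sup>2 / 6 * ((real (b + i))\<^sup>2 - (real i)\<^sup>2))" .
  qed
  also have "\<dots> = real ((a + b) choose a) * exp (- \<theta>\<^sup>2 * (real a * real b * (real a + real b + 1)) / 6)"
    by (simp only: prod.distrib choose_eq_prod[symmetric] exp_sum[OF finite_atLeastAtMost, symmetric]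
        sum_distrib_left[symmetric] sum_square_diff) (simp add: mult_ac)
  finally show ?thesis .
qed

text \<open>Each of the \<open>a\<close> quotients loses at most the fourth-power error of
  \<open>sin_ratio_ge\<close>, taken at the largest angle
  \<open>real (a + b) * \<theta>\<close>.\<close>

lemma sin_prod_ge:
  fixes \<theta> :: real
  assumes "\<theta> > 0" "real (a + b) * \<theta> \<le> 1" "b > 0"
  shows "real ((a + b) choose a) * exp (- \<theta>\<^sup>2 * (real a * real b * (real a + real b + 1)) / 6
            - real a * (real (a + b) * \<theta>) ^ 4)
      \<le> (\<Prod>i=1..a. sin (real (b + i) * \<theta>) / sin (real i * \<theta>))"
proof -
  have "real ((a + b) choose a) * exp (- \<theta>\<^sup>2 * (real a * real b * (real a + real b + 1)) / 6
            - real a * (real (a + b) * \<theta>) ^ 4)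
     = (\<Prod>i=1..a. real (b + i) / real i * exp (- \<theta>\<^sup>2 / 6 * ((real (b + i))\<^sup>2 - (real i)\<^sup>2) - (real (a + b) * \<theta>) ^ 4))"
    by (simp only: prod.distrib choose_eq_prod[symmetric] exp_sum[OF finite_atLeastAtMost, symmetric]
        sum_subtractf[of "\<lambda>i. - \<theta>\<^sup>2 / 6 * ((real (b + i))\<^sup>2 - (real i)\<^sup>2)"]
        sum_distrib_left[symmetric] sum_square_diff) (simp add: mult_ac)
  also have "\<dots> \<le> (\<Prod>i=1..a. sin (real (b + i) * \<theta>) / sin (real i * \<theta>))"
  proof (intro prod_mono conjI)
    fix i assume i: "i \<in> {1..a}"
    show "0 \<le> real (b + i) / real i * exp (- \<theta>\<^sup>2 / 6 * ((real (b + i))\<^sup>2 - (real i)\<^sup>2) - (real (a + b) * \<theta>) ^ 4)"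
      by simp
    have le: "real (b + i) * \<theta> \<le> real (a + b) * \<theta>"
      using i assms by (intro mult_right_mono) auto
    have "real (b + i) / real i * exp (- \<theta>\<^sup>2 / 6 * ((real (b + i))\<^sup>2 - (real i)\<^sup>2) - (real (a + b) * \<theta>) ^ 4)
      \<le> real (b + i) / real i * exp (- \<theta>\<^sup>2 / 6 * ((real (b + i))\<^sup>2 - (real i)\<^sup>2) - (real (b + i) * \<theta>) ^ 4)"
      using le assms by (intro mult_left_mono) (auto intro!: power_mono)
    also have "\<dots> = real (b + i) * \<theta> / (real i * \<theta>) *
        exp (- ((real (b + i) * \<theta>)\<^sup>2 - (real i * \<theta>)\<^sup>2) / 6 - (real (b + i) * \<theta>) ^ 4)"
    proof -
      have "real (b + i) / real i = real (b + i) * \<theta> / (real i * \<theta>)"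
        using assms by simp
      moreover have "- \<theta>\<^sup>2 / 6 * ((real (b + i))\<^sup>2 - (real i)\<^sup>2) = - ((real (b + i) * \<theta>)\<^sup>2 - (real i * \<theta>)\<^sup>2) / 6"
        by (simp add: field_simps power2_eq_square)
      ultimately show ?thesis by (simp only:)
    qed
    also have "\<dots> \<le> sin (real (b + i) * \<theta>) / sin (real i * \<theta>)"
      using order.trans[OF le assms(2)] assms i by (intro sin_ratio_ge) (auto intro!: mult_right_mono)
    finally show "real (b + i) / real i * exp (- \<theta>\<^sup>2 / 6 * ((real (b + i))\<^sup>2 - (real i)\<^sup>2) - (real (a + b) * \<theta>) ^ 4)
       \<le> sin (real (b + i) * \<theta>) / sin (real i * \<theta>)" .
  qed
  finally show ?thesis .
qed

section \<open>Decomposition into blocks\<close>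

lemma norm_qval_le:
  assumes "\<theta> \<noteq> 0" "real (a + b) * \<bar>\<theta>\<bar> \<le> pi"
  shows "norm (qval a b (cis (2 * \<theta>)))
      \<le> real ((a + b) choose a) * exp (- \<theta>\<^sup>2 * (real a * real b * (real a + real b + 1)) / 6)"
proof (cases "a = 0 \<or> b = 0")
  case False
  have "0 < real b * \<bar>\<theta>\<bar>" "0 < real a * \<bar>\<theta>\<bar>"
    using False assms(1) by auto
  then have "real a * \<bar>\<theta>\<bar> < pi" "real b * \<bar>\<theta>\<bar> < pi"
    using assms(2) by (auto simp: distrib_right)
  from qval_cis_eq[OF assms(1) this] show ?thesis
    using sin_prod_le[of "\<bar>\<theta>\<bar>" a b] assms False by (simp add: norm_mult del: of_nat_add of_real_prod)
qed auto

lemma norm_coeff_qrow: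
  "norm q = 1 \<Longrightarrow> norm (coeff (qrow q (a + b)) a) = norm (qval a b q)"
  by (simp add: coeff_qrow norm_mult norm_power)

text \<open>Convexity. The chord is linear in \<open>y\<close>, which for a block is proportional to
  \<open>j * (k - j)\<close>, and this has a closed binomial average.\<close>

lemma exp_minus_le_chord:
  fixes y Y :: real
  assumes "0 \<le> y" "y \<le> Y" "0 < Y"
  shows "exp (- y) \<le> 1 - y / Y * (1 - exp (- Y))"
proof -
  have "exp ((1 - y / Y) *\<^sub>R 0 + (y / Y) *\<^sub>R (- Y)) \<le> (1 - y / Y) * exp 0 + y / Y * exp (- Y)"
    using assms by (intro convex_onD[OF exp_convex]) auto
  then show ?thesis using assms by (simp add: algebra_simps)
qed

lemma binomial_mult_both:
  "real ((m + 2) choose Suc i) * (real (Suc i) * (real (m + 2) - real (Suc i))) =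
    real (m + 2) * real (m + 1) * real (m choose i)"
proof (cases "i \<le> m")
  case True
  have "Suc i * ((m + 2) choose Suc i) = (m + 2) * ((m + 1) choose i)"
    using Suc_times_binomial[of i "m + 1"] by simp
  moreover have "(m + 1 - i) * ((m + 1) choose i) = (m + 1) * (m choose i)"
    using binomial_absorb_comp[of "m + 1" i] by simp
  ultimately have "Suc i * ((m + 2) choose Suc i) * (m + 1 - i) = (m + 2) * ((m + 1) * (m choose i))"
    by (metis mult.assoc mult.commute)
  then have "real (Suc i * ((m + 2) choose Suc i) * (m + 1 - i)) = real ((m + 2) * ((m + 1) * (m choose i)))"
    by (simp only:)
  moreover have "real (m + 1 - i) = real (m + 2) - real (Suc i)" using True by simp
  ultimately show ?thesis by (simp only: of_nat_mult mult_ac)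
next
  case False
  then have "(m + 2) choose Suc i = 0 \<or> Suc i = m + 2" by (cases "i = m + 1") auto
  then show ?thesis using False by (auto simp: binomial_eq_0)
qed

text \<open>Up to normalisation, the mean of \<open>j * (n - j)\<close> under binomial weights with
  \<open>n = m + 2\<close>: absorption from both sides lowers \<open>n\<close> by 2 and
  \<open>j\<close> by 1.\<close>

lemma sum_binomial_mult_both:
  fixes X :: real
  shows "(\<Sum>j\<le>m+2. real ((m + 2) choose j) * (real j * (real (m + 2) - real j)) * X ^ j) =
    real (m + 2) * real (m + 1) * X * (1 + X) ^ m"
proof -
  have "(\<Sum>j\<le>m+2. real ((m + 2) choose j) * (real j * (real (m + 2) - real j)) * X ^ j)
     = (\<Sum>i\<le>m+1. real ((m + 2) choose Suc i) * (real (Suc i) * (real (m + 2) - real (Suc i))) * X ^ Suc i)"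
    using sum.atMost_Suc_shift[of "\<lambda>j. real ((m + 2) choose j) * (real j * (real (m + 2) - real j)) * X ^ j" "m + 1"]
    by (simp del: binomial_Suc_Suc)
  also have "\<dots> = (\<Sum>i\<le>m+1. real (m + 2) * real (m + 1) * X * (real (m choose i) * X ^ i))"
  proof (intro sum.cong refl)
    fix i
    show "real ((m + 2) choose Suc i) * (real (Suc i) * (real (m + 2) - real (Suc i))) * X ^ Suc i
      = real (m + 2) * real (m + 1) * X * (real (m choose i) * X ^ i)"
      unfolding binomial_mult_both by simp
  qed
  also have "\<dots> = real (m + 2) * real (m + 1) * X * (\<Sum>i\<le>m. real (m choose i) * X ^ i)"
    by (simp add: sum_distrib_left binomial_eq_0)
  also have "(\<Sum>i\<le>m. real (m choose i) * X ^ i) = (1 + X) ^ m"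
    using binomial_ring[of X 1 m] by (simp add: add.commute)
  finally show ?thesis .
qed

text \<open>The \<open>j\<close>-th coefficient is at most a binomial coefficient times
  \<open>exp (- y)\<close>, with \<open>y\<close> proportional to \<open>j * (k - j)\<close>. There
  is no gain at \<open>j = 0\<close> and \<open>j = k\<close>, so it appears only in the sum over
  \<open>j\<close>. \<open>Y\<close> is the value of \<open>y\<close> for \<open>j = k / 2\<close>,
  where it is largest.\<close>

lemma coeff_norm_qrow_block_le:
  fixes \<theta> X :: real
  assumes "\<theta> \<noteq> 0" "real k * \<bar>\<theta>\<bar> \<le> pi" "k \<ge> 2" "X > 0"
  defines "Y \<equiv> (real k)\<^sup>2 * (real k + 1) * \<theta>\<^sup>2 / 24"
  shows "coeff_norm X (qrow (cis (2 * \<theta>)) k)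
    \<le> (1 + X) ^ k * (1 - 2 * (X / (1 + X)\<^sup>2) * (1 - exp (- Y)))"
proof -
  define q where "q = cis (2 * \<theta>)"
  obtain m where k: "k = m + 2" using assms(3) by (metis add.commute le_Suc_ex)
  have Y: "Y > 0" using assms by (auto simp: Y_def intro!: divide_pos_pos mult_pos_pos)
  \<comment> \<open>Slope of the chord when it is written as a function of
    \<open>j * (k - j)\<close>.\<close>
  define c where "c = (real k + 1) * \<theta>\<^sup>2 / 6 / Y * (1 - exp (- Y))"
  have coeff: "norm (coeff (qrow q k) j) \<le> real (k choose j) * (1 - real j * (real k - real j) * c)"
    if "j \<le> k" for j
  proof -
    define b where "b = k - j"
    have jb: "k = j + b" using that by (simp add: b_def)
    define y where "y = real j * real b * (real k + 1) * \<theta>\<^sup>2 / 6"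
    have "0 \<le> (real j - real b)\<^sup>2" by simp
    then have "real j * real b \<le> (real k)\<^sup>2 / 4"
      by (simp add: jb power2_eq_square algebra_simps)
    then have "real j * real b * ((real k + 1) * \<theta>\<^sup>2 / 6) \<le> (real k)\<^sup>2 / 4 * ((real k + 1) * \<theta>\<^sup>2 / 6)"
      by (intro mult_right_mono) auto
    then have y: "0 \<le> y" "y \<le> Y" by (auto simp: y_def Y_def)
    have "norm (coeff (qrow q k) j) = norm (qval j b q)"
      unfolding jb by (rule norm_coeff_qrow) (simp add: q_def)
    also have "\<dots> \<le> real ((j + b) choose j) * exp (- \<theta>\<^sup>2 * (real j * real b * (real j + real b + 1)) / 6)"
      unfolding q_def using assms by (intro norm_qval_le) (auto simp: jb)
    also have "- \<theta>\<^sup>2 * (real j * real b * (real j + real b + 1)) / 6 = - y"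
      by (simp add: y_def jb)
    also have "real ((j + b) choose j) * exp (- y) \<le> real ((j + b) choose j) * (1 - y / Y * (1 - exp (- Y)))"
      by (intro mult_left_mono exp_minus_le_chord y Y) simp
    also have "y / Y * (1 - exp (- Y)) = real j * (real k - real j) * c"
      by (simp add: y_def c_def jb)
    finally show ?thesis by (simp add: jb)
  qed
  have c: "c = 4 / (real k)\<^sup>2 * (1 - exp (- Y))"
    using Y assms(1) by (simp add: c_def Y_def divide_simps)
  have "coeff_norm X (qrow q k) = (\<Sum>j\<le>k. norm (coeff (qrow q k) j) * X ^ j)"
    by (rule coeff_norm_eq_sum[OF degree_qrow])
  also have "\<dots> \<le> (\<Sum>j\<le>k. real (k choose j) * (1 - real j * (real k - real j) * c) * X ^ j)"
    using coeff assms by (intro sum_mono mult_right_mono) auto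
  also have "\<dots> = (\<Sum>j\<le>k. real (k choose j) * X ^ j)
      - c * (\<Sum>j\<le>k. real (k choose j) * (real j * (real k - real j)) * X ^ j)"
    by (simp add: sum_distrib_left sum_subtractf[symmetric] algebra_simps)
  also have "(\<Sum>j\<le>k. real (k choose j) * X ^ j) = (1 + X) ^ k"
    using binomial_ring[of X 1 k] by (simp add: add.commute)
  also have "(\<Sum>j\<le>k. real (k choose j) * (real j * (real k - real j)) * X ^ j) =
      real k * (real k - 1) * X * (1 + X) ^ m"
    unfolding k sum_binomial_mult_both by simp
  also have "(1 + X) ^ k - c * (real k * (real k - 1) * X * (1 + X) ^ m)
     \<le> (1 + X) ^ k - (1 - exp (- Y)) * (2 * X * (1 + X) ^ m)"
  proof -
    \<comment> \<open>The left-over factor is \<open>4 * (k - 1) / k\<close>, at least 2 because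
      \<open>k \<ge> 2\<close>.\<close>
    have "2 \<le> 4 / (real k)\<^sup>2 * (real k * (real k - 1))"
      using assms(3) by (simp add: power2_eq_square field_simps)
    then have "2 * ((1 - exp (- Y)) * (X * (1 + X) ^ m)) \<le>
        4 / (real k)\<^sup>2 * (real k * (real k - 1)) * ((1 - exp (- Y)) * (X * (1 + X) ^ m))"
      using Y assms(4) by (intro mult_right_mono mult_nonneg_nonneg) auto
    moreover have "c * (real k * (real k - 1) * X * (1 + X) ^ m) =
        4 / (real k)\<^sup>2 * (real k * (real k - 1)) * ((1 - exp (- Y)) * (X * (1 + X) ^ m))"
      unfolding c by (simp only: mult_ac)
    ultimately show ?thesis by (simp only: mult_ac)
  qed
  also have "\<dots> = (1 + X) ^ k * (1 - 2 * (X / (1 + X)\<^sup>2) * (1 - exp (- Y)))"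
  proof -
    have "(1 + X) ^ k * (X / (1 + X)\<^sup>2) = X * (1 + X) ^ m"
      using assms(4) by (simp add: k power_add power2_eq_square)
    moreover have "K * (1 - 2 * Z * E) = K - 2 * (K * Z) * E" for K Z E :: real
      by (simp add: algebra_simps)
    ultimately have "(1 + X) ^ k * (1 - 2 * (X / (1 + X)\<^sup>2) * (1 - exp (- Y))) =
       (1 + X) ^ k - 2 * (X * (1 + X) ^ m) * (1 - exp (- Y))"
      by (simp only:)
    then show ?thesis by (simp add: mult_ac)
  qed
  finally show ?thesis by (simp add: q_def)
qed

text \<open>Consecutive terms have the ratio \<open>(n - j) * X / (j + 1)\<close> with
  \<open>n = a + b\<close>, which for \<open>X = a / b\<close> is at least 1 below
  \<open>j = a\<close> and at most 1 from there on. Hence \<open>(1 + X) ^ n\<close> is at most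
  \<open>n + 1\<close> times its \<open>a\<close>-th term.\<close>

lemma binomial_term_le_mode:
  fixes X :: real
  assumes "X > 0" "real b * X = real a"
  shows "real ((a + b) choose j) * X ^ j \<le> real ((a + b) choose a) * X ^ a"
proof -
  define n where "n = a + b"
  define T where "T = (\<lambda>j. real (n choose j) * X ^ j)"
  have T_nn: "T j \<ge> 0" for j using assms by (simp add: T_def)
  have rec: "real (Suc j) * T (Suc j) = (real n - real j) * X * T j" if "j \<le> n" for j
  proof -
    have "Suc j * (n choose Suc j) = (n - j) * (n choose j)"
      by (metis binomial_absorb_comp binomial_absorption)
    then have "real (Suc j * (n choose Suc j)) = real ((n - j) * (n choose j))" by (simp only:)
    then have "real (Suc j) * real (n choose Suc j) = (real n - real j) * real (n choose j)"
      using that by (simp only: of_nat_mult of_nat_diff)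
    moreover have "real (Suc j) * T (Suc j) = (real (Suc j) * real (n choose Suc j)) * X ^ Suc j"
      by (simp only: T_def mult.assoc)
    ultimately show ?thesis by (simp add: T_def del: of_nat_Suc)
  qed
  have up: "T j \<le> T (Suc j)" if "j < a" for j
  proof -
    have "real (Suc j) * real b \<le> (real n - real j) * real a"
      using that by (subst mult.commute, intro mult_mono) (auto simp: n_def)
    also have "\<dots> = (real n - real j) * X * real b" by (simp add: assms(2)[symmetric])
    finally have "real (Suc j) \<le> (real n - real j) * X \<or> b = 0"
      by (cases "b = 0") auto
    then have "real (Suc j) \<le> (real n - real j) * X"
      using assms that by auto
    then have "real (Suc j) * T j \<le> real (Suc j) * T (Suc j)"
      using that rec[of j] T_nn[of j] by (auto simp: n_def intro!: mult_right_mono simp del: of_nat_Suc)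
    then show ?thesis by simp
  qed
  have down: "T (Suc j) \<le> T j" if "a \<le> j" for j
  proof (cases "j \<le> n")
    case True
    have "(real n - real j) * X \<le> real b * X"
      using that assms by (intro mult_right_mono) (auto simp: n_def)
    also have "\<dots> \<le> real (Suc j)" using assms that by simp
    finally have "real (Suc j) * T (Suc j) \<le> real (Suc j) * T j"
      using True rec[of j] T_nn[of j] by (auto intro!: mult_right_mono simp del: of_nat_Suc)
    then show ?thesis by simp
  qed (simp add: T_def binomial_eq_0)
  have "T j \<le> T a"
  proof (cases "j \<le> a")
    case True
    then show ?thesis
      by (induction rule: inc_induct) (auto intro: order.trans[OF up])
  next
    case False
    then have "a \<le> j" by simp
    then show ?thesis
      by (induction rule: dec_induct) (auto intro: order.trans[OF down])
  qed
  then show ?thesis by (simp add: T_def n_def)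
qed

text \<open>Up to a phase \<open>qval a b q\<close> is the coefficient of \<open>X ^ a\<close> in
  \<open>qrow q (a + b)\<close>. The norm of the whole product is bounded block by block, and
  division by the largest term of \<open>(1 + X) ^ n\<close> costs only the number of terms.\<close>

lemma norm_qval_blocks_le:
  fixes \<theta> :: real
  assumes "\<theta> \<noteq> 0" "real k * \<bar>\<theta>\<bar> \<le> pi" "k \<ge> 2" "a > 0" "b > 0"
  defines "Y \<equiv> (real k)\<^sup>2 * (real k + 1) * \<theta>\<^sup>2 / 24"
  defines "l \<equiv> real a * real b / (real a + real b)\<^sup>2"
  shows "norm (qval a b (cis (2 * \<theta>)))
    \<le> (real (a + b) + 1) * real ((a + b) choose a) * (1 - 2 * l * (1 - exp (- Y))) ^ ((a + b) div k)"
proof -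
  define X where "X = real a / real b"
  define n where "n = a + b"
  define q where "q = cis (2 * \<theta>)"
  define \<rho> where "\<rho> = 1 - 2 * l * (1 - exp (- Y))"
  have X: "X > 0" "real b * X = real a" using assms by (auto simp: X_def)
  have l: "X / (1 + X)\<^sup>2 = l"
    using assms by (simp add: X_def l_def power2_eq_square field_simps)
  have q: "norm q = 1" by (simp add: q_def)
  have "norm (qval a b q) * X ^ a = norm (coeff (qrow q n) a) * X ^ a"
    by (simp add: n_def norm_coeff_qrow q)
  also have "\<dots> \<le> coeff_norm X (qrow q n)"
    using X by (intro coeff_norm_ge_coeff) auto
  also have "\<dots> = coeff_norm X (qrow q (n div k * k + n mod k))" by simp
  also have "\<dots> \<le> coeff_norm X (qrow q k) ^ (n div k) * (1 + X) ^ (n mod k)"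
    using X q by (intro coeff_norm_qrow_mult_le) auto
  also have "\<dots> \<le> ((1 + X) ^ k * \<rho>) ^ (n div k) * (1 + X) ^ (n mod k)"
    using coeff_norm_qrow_block_le[of \<theta> k X] assms X l
    by (intro mult_right_mono power_mono coeff_norm_nonneg) (auto simp: \<rho>_def q_def)
  also have "\<dots> = (1 + X) ^ (k * (n div k) + n mod k) * \<rho> ^ (n div k)"
    by (simp only: power_mult_distrib power_add power_mult mult_ac)
  also have "\<dots> = (1 + X) ^ n * \<rho> ^ (n div k)"
    by (simp only: mult_div_mod_eq)
  also have "(1 + X) ^ n = (\<Sum>j\<le>n. real (n choose j) * X ^ j)"
    using binomial_ring[of X 1 n] by (simp add: add.commute)
  also have "\<dots> * \<rho> ^ (n div k) \<le> (\<Sum>j\<le>n. real (n choose a) * X ^ a) * \<rho> ^ (n div k)"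
  proof (intro mult_right_mono sum_mono)
    \<comment> \<open>This product bounds a norm, so \<open>\<rho>\<close> cannot be
      negative.\<close>
    have "0 \<le> (1 + X) ^ k * \<rho>"
      using coeff_norm_qrow_block_le[of \<theta> k X] assms X l coeff_norm_nonneg[of X "qrow q k"]
      by (simp add: \<rho>_def q_def)
    moreover have "(1 + X) ^ k > 0" using X by simp
    ultimately have "0 \<le> \<rho>" by (metis zero_le_mult_iff not_less)
    then show "0 \<le> \<rho> ^ (n div k)" by (rule zero_le_power)
  qed (use binomial_term_le_mode[OF X] in \<open>simp add: n_def\<close>)
  finally have "norm (qval a b q) * X ^ a \<le> ((real n + 1) * real (n choose a) * \<rho> ^ (n div k)) * X ^ a"
    by (simp add: algebra_simps)
  then show ?thesis using X by (simp add: n_def \<rho>_def q_def)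
qed

text \<open>\<open>w\<close> is the integer part of the cube root of \<open>a + b\<close>. Blocks of
  length at most \<open>(w + 1)\<^sup>2\<close> suffice for a constant gain each, and at least
  \<open>w - 2\<close> of them fit.\<close>

lemma norm_qval_middle_le:
  fixes \<theta> l0 :: real and a b w :: nat
  assumes "a > 0" "b > 0" "0 < l0" "l0 \<le> real a * real b / (real a + real b)\<^sup>2"
    and "w ^ 3 \<le> a + b" "a + b < (w + 1) ^ 3" "w \<ge> 1"
    and "pi / real (a + b) \<le> \<bar>\<theta>\<bar>" "\<bar>\<theta>\<bar> \<le> pi / 2"
  shows "norm (qval a b (cis (2 * \<theta>)))
    \<le> (real (a + b) + 1) * real ((a + b) choose a) * (1 - 2 / 5 * l0) ^ (w - 2)"
proof -
  define n where "n = a + b"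
  define l where "l = real a * real b / (real a + real b)\<^sup>2"
  have n: "n > 0" using assms by (simp add: n_def)
  have th: "\<bar>\<theta>\<bar> > 0"
  proof (rule less_le_trans[OF _ assms(8)])
    show "0 < pi / real (a + b)" using assms(1) by simp
  qed
  have "4 * (real a * real b) \<le> (real a + real b)\<^sup>2"
    using zero_le_power2[of "real a - real b"] by (simp add: power2_eq_square algebra_simps)
  then have l: "l \<le> 1 / 4"
    using assms by (simp add: l_def field_simps)
  \<comment> \<open>The bound for admissible block lengths:
    \<open>k * \<bar>\<theta>\<bar> \<le> pi\<close> means \<open>k \<le> z\<close>.\<close>
  define z where "z = pi / \<bar>\<theta>\<bar>"
  have z: "2 \<le> z" "z \<le> real n"
    using assms th n by (auto simp: z_def field_simps n_def)
  have zth: "z * \<bar>\<theta>\<bar> = pi" using th by (simp add: z_def)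
  \<comment> \<open>\<open>k\<close> is \<open>(w + 1)\<^sup>2\<close> if that is admissible, else
    the integer part of \<open>z\<close>. In the first case \<open>k ^ 3 \<ge> n\<^sup>2\<close>
    makes the last expression at least \<open>pi\<^sup>2 / 24\<close>; in the second
    \<open>k * \<bar>\<theta>\<bar> \<ge> 3 / 2\<close> and \<open>k + 1 \<ge> 3\<close> make it at
    least \<open>27 / 4 / 24\<close>.\<close>
  have "\<exists>k::nat. k \<ge> 2 \<and> real k \<le> z \<and> k \<le> (w + 1)\<^sup>2 \<and> 1 / 4 \<le> (real k)\<^sup>2 * (real k + 1) * \<theta>\<^sup>2 / 24"
  proof (cases "real ((w + 1)\<^sup>2) \<le> z")
    case True
    define k where "k = (w + 1)\<^sup>2"
    have "real n \<le> real ((w + 1) ^ 3)" using assms(6) unfolding n_def by (intro of_nat_mono) simp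
    then have "(real n)\<^sup>2 \<le> (real ((w + 1) ^ 3))\<^sup>2" by (intro power_mono) auto
    also have "\<dots> = real k ^ 3" by (simp add: k_def flip: power_mult)
    also have "\<dots> \<le> (real k)\<^sup>2 * (real k + 1)" by (simp add: power2_eq_square power3_eq_cube algebra_simps)
    finally have "(real n)\<^sup>2 * \<theta>\<^sup>2 \<le> (real k)\<^sup>2 * (real k + 1) * \<theta>\<^sup>2" by (intro mult_right_mono) auto
    moreover have "pi\<^sup>2 \<le> (real n)\<^sup>2 * \<theta>\<^sup>2"
    proof -
      have "pi \<le> \<bar>\<theta>\<bar> * real n" using assms(8) n unfolding n_def
        by (subst (asm) pos_divide_le_eq) auto
      then have "pi \<le> real n * \<bar>\<theta>\<bar>" by (simp only: mult.commute)
      then have "pi\<^sup>2 \<le> (real n * \<bar>\<theta>\<bar>)\<^sup>2" by (intro power_mono) auto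
      then show ?thesis by (simp add: power_mult_distrib)
    qed
    moreover have "3\<^sup>2 \<le> pi\<^sup>2" using pi_gt3 by (intro power_mono) auto
    ultimately have "1 / 4 \<le> (real k)\<^sup>2 * (real k + 1) * \<theta>\<^sup>2 / 24" by simp
    moreover have "(1 + 1)\<^sup>2 \<le> k" unfolding k_def using assms(7) by (intro power_mono) auto
    ultimately show ?thesis using True by (intro exI[of _ k]) (auto simp: k_def)
  next
    case False
    define k where "k = nat \<lfloor>z\<rfloor>"
    have k: "real k \<le> z" "z < real k + 1" "2 \<le> k"
      using z unfolding k_def by linarith+
    have "pi - \<bar>\<theta>\<bar> \<le> real k * \<bar>\<theta>\<bar>"
      using mult_right_mono[of z "real k + 1" "\<bar>\<theta>\<bar>"] k zth by (simp add: distrib_right)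
    then have "3 / 2 \<le> real k * \<bar>\<theta>\<bar>" using assms(9) pi_gt3 by linarith
    then have "(3 / 2)\<^sup>2 \<le> (real k * \<bar>\<theta>\<bar>)\<^sup>2" by (intro power_mono) auto
    then have "(3 / 2)\<^sup>2 * 3 \<le> (real k * \<bar>\<theta>\<bar>)\<^sup>2 * (real k + 1)"
      using k by (intro mult_mono) auto
    moreover have "(real k * \<bar>\<theta>\<bar>)\<^sup>2 * (real k + 1) = (real k)\<^sup>2 * (real k + 1) * \<theta>\<^sup>2"
      by (simp add: power_mult_distrib mult_ac)
    moreover have "(3 / 2)\<^sup>2 * 3 = (27 / 4 :: real)" by (simp add: power_divide)
    ultimately have "1 / 4 \<le> (real k)\<^sup>2 * (real k + 1) * \<theta>\<^sup>2 / 24" by linarith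
    moreover have "real k \<le> real ((w + 1)\<^sup>2)" using False k by linarith
    then have "k \<le> (w + 1)\<^sup>2" by (simp only: of_nat_le_iff)
    ultimately show ?thesis using k by (intro exI[of _ k]) auto
  qed
  then obtain k :: nat where k: "k \<ge> 2" "real k \<le> z" "k \<le> (w + 1)\<^sup>2"
    "1 / 4 \<le> (real k)\<^sup>2 * (real k + 1) * \<theta>\<^sup>2 / 24" by blast
  define Y where "Y = (real k)\<^sup>2 * (real k + 1) * \<theta>\<^sup>2 / 24"
  have Y: "1 / 4 \<le> Y" using k by (simp add: Y_def)
  have "exp (- Y) \<le> exp (- (1 / 4))" using Y by simp
  \<comment> \<open>From \<open>exp (1 / 4) \<ge> 5 / 4\<close>; this is the origin of the constant
    \<open>2 / 5\<close>.\<close>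
  also have "\<dots> \<le> 4 / 5"
    using exp_ge_add_one_self[of "1 / 4 :: real"] by (simp add: exp_minus field_simps)
  finally have eY: "1 / 5 \<le> 1 - exp (- Y)" by simp
  have kth: "real k * \<bar>\<theta>\<bar> \<le> pi"
    using mult_right_mono[OF k(2), of "\<bar>\<theta>\<bar>"] zth by simp
  have "l0 * (1 / 5) \<le> l * (1 - exp (- Y))"
    using assms eY by (intro mult_mono) (auto simp: l_def)
  then have \<rho>1: "1 - 2 * l * (1 - exp (- Y)) \<le> 1 - 2 / 5 * l0" by simp
  have "l * (1 - exp (- Y)) \<le> 1 / 4 * 1"
    using eY l assms Y by (intro mult_mono) (auto simp: l_def)
  then have \<rho>0: "0 \<le> 1 - 2 * l * (1 - exp (- Y))" by simp
  have div: "w - 2 \<le> n div k"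
  proof -
    have "(w - 2) * k \<le> (w - 2) * (w + 1)\<^sup>2" using k by simp
    \<comment> \<open>\<open>(w - 2) * (w + 1)\<^sup>2\<close> is \<open>w ^ 3 - 3 * w - 2\<close>
      for \<open>w \<ge> 2\<close>; for smaller \<open>w\<close> the truncated \<open>w - 2\<close>
      is 0.\<close>
    also have "\<dots> \<le> w ^ 3"
    proof (cases "w \<ge> 2")
      case True
      then obtain v where "w = v + 2" by (metis add.commute le_Suc_ex)
      then show ?thesis by (simp add: power2_eq_square power3_eq_cube algebra_simps)
    qed simp
    also have "\<dots> \<le> n" using assms by (simp add: n_def)
    finally show ?thesis using k by (simp add: less_eq_div_iff_mult_less_eq)
  qed
  have "(1 - 2 * l * (1 - exp (- Y))) ^ (n div k) \<le> (1 - 2 * l * (1 - exp (- Y))) ^ (w - 2)"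
  proof (rule power_decreasing[OF div \<rho>0])
    have "0 \<le> l * (1 - exp (- Y))"
      using Y by (intro mult_nonneg_nonneg) (auto simp: l_def)
    then show "1 - 2 * l * (1 - exp (- Y)) \<le> 1" by simp
  qed
  also have "\<dots> \<le> (1 - 2 / 5 * l0) ^ (w - 2)"
    using \<rho>0 \<rho>1 by (intro power_mono) auto
  finally have "(real (a + b) + 1) * real ((a + b) choose a) * (1 - 2 * l * (1 - exp (- Y))) ^ (n div k)
      \<le> (real (a + b) + 1) * real ((a + b) choose a) * (1 - 2 / 5 * l0) ^ (w - 2)"
    by (intro mult_left_mono) auto
  moreover have "norm (qval a b (cis (2 * \<theta>)))
    \<le> (real (a + b) + 1) * real ((a + b) choose a) * (1 - 2 * l * (1 - exp (- Y))) ^ (n div k)"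
    unfolding l_def Y_def n_def using th kth k assms by (intro norm_qval_blocks_le) auto
  ultimately show ?thesis by linarith
qed

lemma poly_times_power_bounded:
  fixes \<kappa> :: real
  assumes "0 < \<kappa>" "\<kappa> < 1"
  shows "\<exists>B. \<forall>w::nat. (real w + 1) ^ p * \<kappa> ^ (w - 2) \<le> B"
proof -
  define c where "c = - ln \<kappa>"
  have c: "c > 0" using assms by (simp add: c_def)
  have "filterlim (\<lambda>w. c * (real w + 1)) at_top sequentially"
    using c by real_asymp
  from filterlim_compose[OF tendsto_power_div_exp_0[of p] this]
  have "(\<lambda>w. (c * (real w + 1)) ^ p / exp (c * (real w + 1))) \<longlonglongrightarrow> 0" .
  then have "Bseq (\<lambda>w. (c * (real w + 1)) ^ p / exp (c * (real w + 1)))"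
    by (intro convergent_imp_Bseq convergentI)
  then obtain K where K: "\<And>w. norm ((c * (real w + 1)) ^ p / exp (c * (real w + 1))) \<le> K"
    by (auto simp: Bseq_def)
  have "(real w + 1) ^ p * \<kappa> ^ (w - 2) \<le> K / c ^ p / \<kappa> ^ 3" for w
  proof -
    have e: "exp (c * (real w + 1)) = inverse (\<kappa> ^ (w + 1))"
    proof -
      have "exp (c * (real w + 1)) = exp (- (real (w + 1) * ln \<kappa>))"
        by (simp add: c_def algebra_simps)
      also have "\<dots> = inverse (exp (ln \<kappa>) ^ (w + 1))"
        by (simp only: exp_minus exp_of_nat_mult)
      finally show ?thesis using assms by simp
    qed
    have "c ^ p * (real w + 1) ^ p * \<kappa> ^ (w + 1) \<le> K"
      using order.trans[OF abs_ge_self K[of w, unfolded real_norm_def]]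
      by (simp add: e power_mult_distrib divide_inverse)
    then have "(real w + 1) ^ p * \<kappa> ^ (w + 1) \<le> K / c ^ p"
      using c by (simp add: field_simps)
    \<comment> \<open>Equality for \<open>w \<ge> 2\<close>; for smaller \<open>w\<close> the
      subtraction is truncated and the left side is smaller.\<close>
    moreover have "\<kappa> ^ (w - 2) * \<kappa> ^ 3 \<le> \<kappa> ^ (w + 1)"
      using assms unfolding power_add[symmetric] by (intro power_decreasing) auto
    from mult_left_mono[OF this, of "(real w + 1) ^ p"]
    have "(real w + 1) ^ p * (\<kappa> ^ (w - 2) * \<kappa> ^ 3) \<le> (real w + 1) ^ p * \<kappa> ^ (w + 1)"
by simp
    ultimately have "(real w + 1) ^ p * \<kappa> ^ (w - 2) * \<kappa> ^ 3 \<le> K / c ^ p"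
      by (simp only: mult.assoc)
    then show ?thesis using assms by (subst pos_le_divide_eq) auto
  qed
  then show ?thesis by blast
qed

lemma ex_floor_cube_root:
  fixes n :: nat
  assumes "n > 0"
  shows "\<exists>w\<ge>1. w ^ 3 \<le> n \<and> n < (w + 1) ^ 3"
proof -
  define w where "w = (GREATEST w. w ^ 3 \<le> n)"
  have bound: "y \<le> n" if "y ^ 3 \<le> n" for y :: nat
    using that self_le_power[of y 3] by (cases "y = 0") auto
  have w: "w ^ 3 \<le> n"
    unfolding w_def by (rule GreatestI_nat[of _ 0 n]) (use bound in auto)
  have le: "y \<le> w" if "y ^ 3 \<le> n" for y
    unfolding w_def using that bound by (intro Greatest_le_nat) auto
  have "1 \<le> w" by (rule le) (use assms in simp)
  moreover have "n < (w + 1) ^ 3" using le[of "w + 1"] by (rule_tac ccontr) simp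
  ultimately show ?thesis using w by blast
qed

section \<open>Fourier inversion and the derivatives of the normal density\<close>

definition fdiff :: "(int \<Rightarrow> real) \<Rightarrow> int \<Rightarrow> real" where
  "fdiff u k = u (k + 1) - u k"

lemma has_vector_derivative_cis_mult:
  "((\<lambda>t. cis (c * t)) has_vector_derivative \<i> * of_real c * cis (c * t)) (at t within S)"
proof -
  have "((\<lambda>t. exp (\<i> * of_real c * of_real t)) has_vector_derivative
      (\<i> * of_real c) * exp (\<i> * of_real c * of_real t)) (at t within S)"
    by (rule has_vector_derivative_real_field) (auto intro!: derivative_eq_intros)
  then show ?thesis by (simp add: cis_conv_exp mult.assoc)
qed

lemma integral_cis_int:
  fixes l :: int
  shows "(\<integral>t. indicator {-pi..pi} t *\<^sub>R cis (real_of_int l * t) \<partial>lborel) = (if l = 0 then 2 * of_real pi else 0)"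
proof (cases "l = 0")
  case True
  have "(\<integral>t. indicator {-pi..pi} t *\<^sub>R (1::complex) \<partial>lborel) = complex_of_real pi - complex_of_real (- pi)"
    by (rule integral_FTC_atLeastAtMost) (auto intro!: derivative_eq_intros has_vector_derivative_of_real)
  then show ?thesis using True by simp
next
  case False
  have "(\<integral>t. indicator {-pi..pi} t *\<^sub>R cis (real_of_int l * t) \<partial>lborel) =
    cis (real_of_int l * pi) / (\<i> * of_int l) - cis (real_of_int l * (- pi)) / (\<i> * of_int l)"
  proof (rule integral_FTC_atLeastAtMost)
    fix t
    have "((\<lambda>t. 1 / (\<i> * of_int l) * cis (real_of_int l * t)) has_vector_derivative
       1 / (\<i> * of_int l) * (\<i> * of_real (real_of_int l) * cis (real_of_int l * t))) (at t within {-pi..pi})"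
      by (intro has_vector_derivative_mult_right has_vector_derivative_cis_mult)
    then show "((\<lambda>t. cis (real_of_int l * t) / (\<i> * of_int l)) has_vector_derivative
      cis (real_of_int l * t)) (at t within {-pi..pi})"
      using False by simp
  qed (auto intro!: continuous_intros)
  also have "cis (real_of_int l * (- pi)) = cis (real_of_int l * pi)"
    using sin_npi_int[of l] by (simp add: complex_eq_iff mult.commute)
  finally show ?thesis using False by simp
qed

lemma continuous_on_qval_cis [continuous_intros]: "continuous_on S (\<lambda>t. qval a b (cis t))"
  unfolding qval_def by (intro continuous_intros)

lemma gauss_prob_eq_coeff:
  "gauss_prob a b m = (\<Sum>k\<le>a*b. if int k = m then coeff (qbin a b) k / real ((a + b) choose a) else 0)"
proof (cases "0 \<le> m \<and> m \<le> int (a * b)")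
  case True
  then obtain k where "m = int k" using nonneg_int_cases by blast
  then show ?thesis using True
    by (simp add: gauss_prob_def gauss_coeff_def gauss_poly_eq_qbin del: of_nat_mult)
next
  case False
  then have "int k \<noteq> m" if "k \<le> a * b" for k using that zle_int[of k "a * b"] by (auto simp del: of_nat_mult zle_int)
  with False show ?thesis by (auto simp: gauss_prob_def gauss_coeff_def)
qed

text \<open>Orthogonality of the functions \<open>cis (l * t)\<close> extracts the coefficient, and
  each forward difference multiplies the integrand by \<open>cis (- t) - 1\<close>.\<close>

lemma gauss_prob_fourier:
  "complex_of_real ((fdiff ^^ j) (gauss_prob a b) m) = 1 / (2 * of_real pi) *
    (\<integral>t. indicator {-pi..pi} t *\<^sub>R ((cis (- t) - 1) ^ j * cis (- (real_of_int m * t)) *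
      (qval a b (cis t) / of_nat ((a + b) choose a))) \<partial>lborel)"
proof (induction j arbitrary: m)
  case 0
  let ?B = "of_nat ((a + b) choose a) :: complex"
  let ?c = "\<lambda>k. complex_of_real (coeff (qbin a b) k) / ?B"
  have "(\<integral>t. indicator {-pi..pi} t *\<^sub>R (cis (- (real_of_int m * t)) * (qval a b (cis t) / ?B)) \<partial>lborel)
    = (\<integral>t. (\<Sum>k\<le>a*b. ?c k * (indicator {-pi..pi} t *\<^sub>R cis (real_of_int (int k - m) * t))) \<partial>lborel)"
  proof (intro Bochner_Integration.integral_cong refl)
    fix t
    have "cis (- (real_of_int m * t)) * cis t ^ k = cis (real_of_int (int k - m) * t)" for k
      by (simp add: Complex.DeMoivre cis_mult algebra_simps)
    moreover have "cis (- (real_of_int m * t)) * (qval a b (cis t) / ?B) =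
       (\<Sum>k\<le>a*b. ?c k * (cis (- (real_of_int m * t)) * cis t ^ k))"
      by (simp add: qval_eq_sum sum_divide_distrib sum_distrib_left mult_ac)
    ultimately show "indicator {-pi..pi} t *\<^sub>R (cis (- (real_of_int m * t)) * (qval a b (cis t) / ?B)) =
       (\<Sum>k\<le>a*b. ?c k * (indicator {-pi..pi} t *\<^sub>R cis (real_of_int (int k - m) * t)))"
      by (simp only: scaleR_sum_right mult_scaleR_right)
  qed
  also have "\<dots> = (\<Sum>k\<le>a*b. ?c k * (\<integral>t. indicator {-pi..pi} t *\<^sub>R cis (real_of_int (int k - m) * t) \<partial>lborel))"
  proof (subst Bochner_Integration.integral_sum)
    fix k
    have "set_integrable lborel {-pi..pi} (\<lambda>t. cis (real_of_int (int k - m) * t))"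
      by (intro borel_integrable_atLeastAtMost' continuous_intros)
    then show "integrable lborel (\<lambda>t. ?c k * (indicator {-pi..pi} t *\<^sub>R cis (real_of_int (int k - m) * t)))"
      unfolding set_integrable_def by (intro integrable_mult_right) simp
  qed (simp only: integral_mult_right_zero)
  also have "\<dots> = (\<Sum>k\<le>a*b. ?c k * (if int k = m then 2 * of_real pi else 0))"
    unfolding integral_cis_int by simp
  also have "\<dots> = 2 * of_real pi * complex_of_real (gauss_prob a b m)"
    unfolding gauss_prob_eq_coeff of_real_sum sum_distrib_left
    by (intro sum.cong) auto
  finally show ?case by simp
next
  case (Suc j)
  let ?f = "\<lambda>m t. indicator {-pi..pi} t *\<^sub>R ((cis (- t) - 1) ^ j * cis (- (real_of_int m * t)) *
      (qval a b (cis t) / of_nat ((a + b) choose a)))"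
  have int: "integrable lborel (?f m)" for m
    unfolding set_integrable_def[symmetric]
    by (intro borel_integrable_atLeastAtMost' continuous_intros) auto
  have "complex_of_real ((fdiff ^^ Suc j) (gauss_prob a b) m) = 1 / (2 * of_real pi) *
     (\<integral>t. ?f (m + 1) t - ?f m t \<partial>lborel)"
    using Bochner_Integration.integral_diff[OF int int, of "m + 1" m]
    by (simp add: fdiff_def Suc right_diff_distrib)
  also have "(\<lambda>t. ?f (m + 1) t - ?f m t) = (\<lambda>t. indicator {-pi..pi} t *\<^sub>R ((cis (- t) - 1) ^ Suc j * cis (- (real_of_int m * t)) *
      (qval a b (cis t) / of_nat ((a + b) choose a))))"
  proof
    fix t
    have "cis (- (real_of_int (m + 1) * t)) = cis (- t) * cis (- (real_of_int m * t))"
      by (simp add: cis_mult algebra_simps)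
    then show "?f (m + 1) t - ?f m t = indicator {-pi..pi} t *\<^sub>R ((cis (- t) - 1) ^ Suc j * cis (- (real_of_int m * t)) *
      (qval a b (cis t) / of_nat ((a + b) choose a)))"
      by (simp add: algebra_simps)
  qed
  finally show ?case .
qed

lemma norm_cis_minus_1_le: "norm (cis y - 1) \<le> \<bar>y\<bar>"
proof -
  have "cis y - 1 = - (1 - cis (2 * (y / 2)) ^ 1)" by simp
  also have "norm \<dots> = 2 * \<bar>sin (y / 2)\<bar>"
    unfolding one_minus_cis_pow norm_minus_cancel by (simp add: norm_mult)
  also have "\<dots> \<le> \<bar>y\<bar>" using abs_sin_x_le_abs_x[of "y / 2"] by simp
  finally show ?thesis .
qed

text \<open>The \<open>j\<close>-th derivative at \<open>x\<close> of the standard normal density,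
  as the inverse Fourier integral that dominated convergence produces.\<close>

definition gauss_jet :: "nat \<Rightarrow> real \<Rightarrow> complex" where
  "gauss_jet j x = 1 / (2 * of_real pi) *
     (\<integral>s. (- \<i> * of_real s) ^ j * cis (- (x * s)) * of_real (exp (- s\<^sup>2 / 2)) \<partial>lborel)"

lemma integrable_power_gauss: "integrable lborel (\<lambda>s::real. \<bar>s\<bar> ^ j * exp (- s\<^sup>2 / 2))"
proof -
  have "integrable lborel (\<lambda>s. sqrt (2 * pi) * (std_normal_density s * \<bar>s\<bar> ^ j))"
    by (intro integrable_mult_right integrable_std_normal_moment_abs)
  then show ?thesis by (simp add: std_normal_density_def mult.commute)
qed

lemma integrable_gauss_jet:
  "integrable lborel (\<lambda>s. (- \<i> * of_real s) ^ j * cis (- (x * s)) * of_real (exp (- s\<^sup>2 / 2)))"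
proof (rule Bochner_Integration.integrable_bound[OF integrable_power_gauss[of j]])
  have "(\<lambda>s. (- \<i> * of_real s) ^ j * cis (- (x * s)) * of_real (exp (- s\<^sup>2 / 2))) \<in> borel_measurable borel"
    by (intro borel_measurable_continuous_onI continuous_intros) auto
  then show "(\<lambda>s. (- \<i> * of_real s) ^ j * cis (- (x * s)) * of_real (exp (- s\<^sup>2 / 2))) \<in> borel_measurable lborel"
    by simp
qed (auto simp: norm_mult norm_power)

lemma power_gauss_tendsto_0: "((\<lambda>s::real. s ^ j * exp (- s\<^sup>2 / 2)) \<longlongrightarrow> 0) at_top"
proof (rule tendsto_sandwich[OF _ _ tendsto_const tendsto_power_div_exp_0[of j]])
  show "\<forall>\<^sub>F s::real in at_top. s ^ j * exp (- s\<^sup>2 / 2) \<le> s ^ j / exp s"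
    using eventually_ge_at_top[of 2]
  proof eventually_elim
    case (elim s)
    then have "s * 2 \<le> s * s" by (intro mult_left_mono) auto
    then have "exp (- s\<^sup>2 / 2) \<le> exp (- s)" by (simp add: power2_eq_square)
    from mult_left_mono[OF this, of "s ^ j"] elim
    have "s ^ j * exp (- s\<^sup>2 / 2) \<le> s ^ j * exp (- s)" by simp
    also have "s ^ j * exp (- s) = s ^ j / exp s" by (simp only: exp_minus divide_inverse)
    finally show ?case .
  qed
  show "\<forall>\<^sub>F s::real in at_top. 0 \<le> s ^ j * exp (- s\<^sup>2 / 2)"
    using eventually_ge_at_top[of 0] by eventually_elim auto
qed

text \<open>The derivative of the integrand in \<open>s\<close> combines the integrands of orders
  \<open>j - 1\<close>, \<open>j\<close> and \<open>j + 1\<close>, and its integral is 0 because the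
  integrand vanishes at both ends. For \<open>j = 0\<close> the truncated \<open>j - 1\<close> is
  multiplied by 0.\<close>

lemma gauss_jet_Suc:
  "gauss_jet (Suc j) x = - of_real x * gauss_jet j x - of_nat j * gauss_jet (j - 1) x"
proof -
  define F where "F = (\<lambda>j s. (- \<i> * of_real s) ^ j * cis (- (x * s)) * complex_of_real (exp (- s\<^sup>2 / 2)))"
  define f where "f = (\<lambda>s. - \<i> * (of_nat j * F (j - 1) s + of_real x * F j s + F (Suc j) s))"
  have intF: "integrable lborel (F j)" for j
    unfolding F_def by (rule integrable_gauss_jet)
  have intf: "integrable lborel f"
    unfolding f_def by (intro Bochner_Integration.integrable_add integrable_mult_right intF)
  have deriv: "(F j has_vector_derivative f s) (at s)" for s
  proof -
    have "((\<lambda>z. (- \<i> * z) ^ j * exp (- \<i> * of_real x * z) * exp (- z\<^sup>2 / 2)) has_field_derivative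
       - \<i> * (of_nat j * ((- \<i> * z) ^ (j - 1) * exp (- \<i> * of_real x * z) * exp (- z\<^sup>2 / 2))
         + of_real x * ((- \<i> * z) ^ j * exp (- \<i> * of_real x * z) * exp (- z\<^sup>2 / 2))
         + (- \<i> * z) ^ Suc j * exp (- \<i> * of_real x * z) * exp (- z\<^sup>2 / 2))) (at z)" for z :: complex
    proof -
      have 1: "((\<lambda>z. (- \<i> * z) ^ j) has_field_derivative of_nat j * (- \<i> * z) ^ (j - 1) * (- \<i>)) (at z)"
        by (auto intro!: derivative_eq_intros)
      have 2: "((\<lambda>z. exp (- \<i> * of_real x * z)) has_field_derivative
          (- \<i> * of_real x) * exp (- \<i> * of_real x * z)) (at z)"
        by (auto intro!: derivative_eq_intros)
      have 3: "((\<lambda>z. exp (- z\<^sup>2 / 2)) has_field_derivative (- z) * exp (- z\<^sup>2 / 2)) (at z)"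
        by (auto intro!: derivative_eq_intros)
      show ?thesis
        by (rule DERIV_cong[OF DERIV_mult[OF DERIV_mult[OF 1 2] 3]]) (simp add: algebra_simps)
    qed
    from has_vector_derivative_real_field[OF this[of "of_real s"], of UNIV] show ?thesis
      by (simp add: F_def f_def cis_conv_exp exp_of_real[symmetric] mult_ac)
  qed
  have cont: "isCont f s" for s
  proof -
    have "continuous_on UNIV f"
      unfolding f_def F_def by (intro continuous_intros) auto
    then show ?thesis by (simp add: continuous_on_eq_continuous_at)
  qed
  have normF: "norm (F j s) = \<bar>s\<bar> ^ j * exp (- s\<^sup>2 / 2)" for s
    by (simp add: F_def norm_mult norm_power)
  have top: "(F j \<longlongrightarrow> 0) at_top"
  proof (rule tendsto_norm_zero_cancel)
    have "\<forall>\<^sub>F s in at_top. s ^ j * exp (- s\<^sup>2 / 2) = norm (F j s)"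
      using eventually_ge_at_top[of 0] by eventually_elim (auto simp: normF)
    then show "((\<lambda>s. norm (F j s)) \<longlongrightarrow> 0) at_top"
      by (rule Lim_transform_eventually[OF power_gauss_tendsto_0])
  qed
  have "((\<lambda>s. norm (F j (- s))) \<longlongrightarrow> 0) at_top"
    using tendsto_norm_zero[OF top] by (simp add: normF)
  then have bot: "(F j \<longlongrightarrow> 0) at_bot"
    unfolding filterlim_at_bot_mirror by (rule tendsto_norm_zero_cancel)
  have "(LBINT s=-\<infinity>..\<infinity>. f s) = 0 - 0"
  proof (rule interval_integral_FTC_integrable[where F = "F j"])
    show "set_integrable lborel (einterval (- \<infinity>) \<infinity>) f"
      using intf by (simp add: set_integrable_def)
    show "((F j \<circ> real_of_ereal) \<longlongrightarrow> 0) (at_right (- \<infinity>))" "((F j \<circ> real_of_ereal) \<longlongrightarrow> 0) (at_left \<infinity>)"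
      using top bot by (simp_all add: ereal_tendsto_simps)
  qed (use deriv cont in auto)
  then have "integral\<^sup>L lborel f = 0"
    by (simp add: interval_lebesgue_integral_def set_lebesgue_integral_def)
  then have "of_nat j * integral\<^sup>L lborel (F (j - 1)) + of_real x * integral\<^sup>L lborel (F j) + integral\<^sup>L lborel (F (Suc j)) = 0"
    unfolding f_def using intF by simp
  moreover have "integral\<^sup>L lborel (F k) = 2 * of_real pi * gauss_jet k x" for k
    by (simp add: gauss_jet_def F_def)
  ultimately have "2 * of_real pi * (of_nat j * gauss_jet (j - 1) x + of_real x * gauss_jet j x + gauss_jet (Suc j) x) = 0"
    by (simp add: algebra_simps)
  then have "of_nat j * gauss_jet (j - 1) x + of_real x * gauss_jet j x + gauss_jet (Suc j) x = 0"
    by (simp only: mult_eq_0_iff) auto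
  then show ?thesis by algebra
qed

text \<open>The normal density is its own Fourier transform up to scaling: this is its
  characteristic function at \<open>- x\<close>.\<close>

lemma gauss_jet_0: "gauss_jet 0 x = of_real (exp (- x\<^sup>2 / 2) / sqrt (2 * pi))"
proof -
  have "of_real (exp (- x\<^sup>2 / 2)) = char std_normal_distribution (- x)"
    by (simp add: char_std_normal_distribution)
  also have "\<dots> = (\<integral>s. std_normal_density s *\<^sub>R iexp (- x * s) \<partial>lborel)"
    unfolding char_def by (subst integral_density) auto
  also have "\<dots> = (\<integral>s. of_real (1 / sqrt (2 * pi)) * (cis (- (x * s)) * of_real (exp (- s\<^sup>2 / 2))) \<partial>lborel)"
    by (intro Bochner_Integration.integral_cong refl)
      (simp add: std_normal_density_def cis_conv_exp scaleR_conv_of_real mult_ac)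
  also have "\<dots> = of_real (1 / sqrt (2 * pi)) * (2 * of_real pi * gauss_jet 0 x)"
    by (simp add: gauss_jet_def)
  finally have "of_real (exp (- x\<^sup>2 / 2)) = of_real (2 * pi / sqrt (2 * pi)) * gauss_jet 0 x" by simp
  also have "2 * pi / sqrt (2 * pi) = sqrt (2 * pi)" by (simp add: real_div_sqrt)
  finally show ?thesis by (simp add: field_simps)
qed

section \<open>The local limit theorem\<close>

text \<open>A difference quotient of the exponential at 0, with step
  \<open>1 / \<sigma> i\<close>.\<close>

lemma tendsto_scaled_cis_minus_1:
  assumes "filterlim \<sigma> at_top sequentially"
  shows "(\<lambda>i. of_real (\<sigma> i) * (cis (- (s / \<sigma> i)) - 1)) \<longlonglongrightarrow> - \<i> * of_real s"
proof -
  have "((\<lambda>z. exp (- \<i> * of_real s * z)) has_field_derivative - \<i> * of_real s) (at 0)"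
    by (auto intro!: derivative_eq_intros)
  from DERIV_D[OF this]
  have d: "((\<lambda>h. (exp (- \<i> * of_real s * h) - 1) / h) \<longlongrightarrow> - \<i> * of_real s) (at 0)" by simp
  have "(\<lambda>i. complex_of_real (inverse (\<sigma> i))) \<longlonglongrightarrow> of_real 0"
    by (intro tendsto_of_real tendsto_inverse_0_at_top assms)
  moreover have ev: "\<forall>\<^sub>F i in sequentially. \<sigma> i > 0"
    using assms by (auto simp: filterlim_at_top_dense)
  ultimately have "filterlim (\<lambda>i. complex_of_real (inverse (\<sigma> i))) (at 0) sequentially"
    by (auto simp: filterlim_at elim: eventually_mono)
  from filterlim_compose[OF d this]
  have "(\<lambda>i. (exp (- \<i> * of_real s * of_real (inverse (\<sigma> i))) - 1) / of_real (inverse (\<sigma> i))) \<longlonglongrightarrow> - \<i> * of_real s" .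
  moreover have "\<forall>\<^sub>F i in sequentially. (exp (- \<i> * of_real s * of_real (inverse (\<sigma> i))) - 1) / of_real (inverse (\<sigma> i))
      = of_real (\<sigma> i) * (cis (- (s / \<sigma> i)) - 1)"
    using ev by eventually_elim (simp add: cis_conv_exp divide_inverse mult_ac)
  ultimately show ?thesis by (rule Lim_transform_eventually)
qed

lemma gauss_sd_pos: "a > 0 \<Longrightarrow> b > 0 \<Longrightarrow> gauss_sd a b > 0"
  by (auto simp: gauss_sd_def intro!: divide_pos_pos mult_pos_pos)

lemma gauss_sd_sq: "(gauss_sd a b)\<^sup>2 = real a * real b * (real a + real b + 1) / 12"
  by (simp add: gauss_sd_def)

text \<open>Crude, but any power of \<open>n\<close> will do, since it meets exponential decay in
  the cube root of \<open>n\<close>.\<close>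

lemma gauss_sd_le:
  assumes "a > 0" "b > 0"
  shows "gauss_sd a b \<le> (real a + real b)\<^sup>2"
proof (rule power2_le_imp_le)
  define n where "n = real a + real b"
  have n: "n \<ge> 1" using assms by (simp add: n_def)
  have "real a * real b * (n + 1) \<le> n * n * (2 * n)"
    using n by (intro mult_mono) (auto simp: n_def)
  also have "\<dots> \<le> 12 * (n\<^sup>2)\<^sup>2"
    using n self_le_power[of n 4] power_increasing[of 3 4 n] by (simp add: power2_eq_square power3_eq_cube power4_eq_xxxx)
  finally show "(gauss_sd a b)\<^sup>2 \<le> ((real a + real b)\<^sup>2)\<^sup>2"
    by (simp add: gauss_sd_sq n_def)
qed simp

lemma gauss_sd_sq_ge:
  assumes "a > 0" "b > 0" "l0 \<le> real a * real b / (real a + real b)\<^sup>2" "l0 > 0"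
  shows "l0 * (real a + real b) ^ 3 / 12 \<le> (gauss_sd a b)\<^sup>2"
proof -
  define n where "n = real a + real b"
  have n: "n > 0" using assms by (simp add: n_def)
  have "l0 * n\<^sup>2 \<le> real a * real b"
    using assms n by (simp add: n_def field_simps)
  then have "l0 * n\<^sup>2 * n \<le> real a * real b * (n + 1)"
    by (rule mult_mono) (use n in auto)
  moreover have "l0 * n\<^sup>2 * n = l0 * n ^ 3" by (simp add: power2_eq_square power3_eq_cube)
  ultimately have "l0 * n ^ 3 \<le> real a * real b * (n + 1)" by (simp only:)
  then show ?thesis by (simp add: gauss_sd_sq n_def)
qed

lemma norm_qval_central_le:
  assumes "a > 0" "b > 0" "real (a + b) * \<bar>\<theta>\<bar> \<le> pi"
  shows "norm (qval a b (cis (2 * \<theta>))) / real ((a + b) choose a) \<le> exp (- (2 * \<theta> * gauss_sd a b)\<^sup>2 / 2)"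
proof (cases "\<theta> = 0")
  case True
  have "qval a b 1 = of_real (poly (qbin a b) 1)"
    unfolding qval_eq_sum poly_eq_sum_atMost[OF degree_qbin] by simp
  then show ?thesis using True by (simp add: poly_qbin_1)
next
  case False
  have "- \<theta>\<^sup>2 * (real a * real b * (real a + real b + 1)) / 6 = - (2 * \<theta> * gauss_sd a b)\<^sup>2 / 2"
    by (simp add: power_mult_distrib gauss_sd_sq)
  with norm_qval_le[OF False assms(3)]
  have "norm (qval a b (cis (2 * \<theta>))) \<le> real ((a + b) choose a) * exp (- (2 * \<theta> * gauss_sd a b)\<^sup>2 / 2)"
    by (simp only:)
  then show ?thesis by (subst pos_divide_le_eq) (simp_all add: mult.commute)
qed

text \<open>\<open>l0\<close> bounds the variance below by a multiple of \<open>n ^ 3\<close> and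
  keeps the gain of every block away from 0; both would fail if \<open>a / (a + b)\<close> drifted
  to 0 or 1.\<close>

locale balanced_sequence =
  fixes a b :: "nat \<Rightarrow> nat" and l0 :: real
  assumes a_pos: "a i > 0" and b_pos: "b i > 0" and l0_pos: "l0 > 0"
    and balanced: "l0 \<le> real (a i) * real (b i) / (real (a i) + real (b i))\<^sup>2"
    and a_top: "filterlim a at_top sequentially"
begin

definition "n i = real (a i) + real (b i)"
definition "sd i = gauss_sd (a i) (b i)"
definition "B i = real ((a i + b i) choose a i)"

lemma n_pos: "n i > 0" and sd_pos: "sd i > 0" and B_pos: "B i > 0"
  using a_pos b_pos gauss_sd_pos by (auto simp: n_def sd_def B_def add_pos_pos)

lemma n_top: "filterlim n at_top sequentially"
proof (rule filterlim_at_top_mono)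
  show "filterlim (\<lambda>i. real (a i)) at_top sequentially"
    by (rule filterlim_compose[OF filterlim_real_sequentially a_top])
qed (simp add: n_def)

lemma sd_sq_ge: "l0 * n i ^ 3 / 12 \<le> (sd i)\<^sup>2"
  using gauss_sd_sq_ge[OF a_pos b_pos balanced l0_pos] by (simp add: n_def sd_def)

lemma n_div_sd_sq_le: "(n i / sd i)\<^sup>2 \<le> 12 / l0 / n i"
proof -
  have "(n i)\<^sup>2 * (l0 * n i) = l0 * n i ^ 3" by (simp add: power2_eq_square power3_eq_cube)
  then show ?thesis
    using sd_sq_ge[of i] n_pos[of i] sd_pos[of i] l0_pos by (simp add: field_simps)
qed

text \<open>In the variable \<open>s = t * sd i\<close> the central range is
  \<open>\<bar>s\<bar> \<le> 2 * pi * sd i / n i\<close>, so it exhausts the line.\<close>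

lemma n_div_sd: "(\<lambda>i. n i / sd i) \<longlonglongrightarrow> 0"
proof -
  have "(\<lambda>i. 12 / l0 / n i) \<longlonglongrightarrow> 0"
    by (rule tendsto_divide_0[OF tendsto_const filterlim_at_top_imp_at_infinity[OF n_top]])
  then have "(\<lambda>i. (n i / sd i)\<^sup>2) \<longlonglongrightarrow> 0"
    by (rule tendsto_sandwich[OF _ _ tendsto_const, rotated 2])
      (use n_div_sd_sq_le in \<open>auto intro!: always_eventually\<close>)
  then have "(\<lambda>i. sqrt ((n i / sd i)\<^sup>2)) \<longlonglongrightarrow> sqrt 0" by (rule tendsto_real_sqrt)
  then show ?thesis using n_pos sd_pos by (simp add: less_imp_le)
qed

lemma sd_top: "filterlim sd at_top sequentially"
proof (rule filterlim_at_top_mono[OF n_top])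
  have "\<forall>\<^sub>F i in sequentially. n i / sd i < 1"
    using n_div_sd by (rule order_tendstoD) simp
  then show "\<forall>\<^sub>F i in sequentially. n i \<le> sd i"
    by eventually_elim (use sd_pos in \<open>simp add: field_simps\<close>)
qed

text \<open>For \<open>s = 2 * \<theta> * sd i\<close> one has
  \<open>\<bar>s\<bar> \<le> pi * sd i\<close>, so the extra factors yield the integrable bound
  \<open>C / (1 + s\<^sup>2)\<close> for \<open>\<bar>s\<bar> ^ j\<close> times the normalized
  value.\<close>

lemma tail_bound:
  "\<exists>C\<ge>0. \<forall>i \<theta>. pi / n i \<le> \<bar>\<theta>\<bar> \<longrightarrow> \<bar>\<theta>\<bar> \<le> pi / 2 \<longrightarrow>
    norm (qval (a i) (b i) (cis (2 * \<theta>))) / B i * (pi * sd i) ^ j * (1 + (pi * sd i)\<^sup>2) \<le> C"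
proof -
  define \<kappa> where "\<kappa> = 1 - 2 / 5 * l0"
  have "4 * (real (a 0) * real (b 0)) \<le> (real (a 0) + real (b 0))\<^sup>2"
    using zero_le_power2[of "real (a 0) - real (b 0)"] by (simp add: power2_eq_square algebra_simps)
  then have "real (a 0) * real (b 0) / (real (a 0) + real (b 0))\<^sup>2 \<le> 1 / 4"
    using n_pos[of 0] by (simp add: n_def field_simps)
  then have "l0 \<le> 1 / 4" using balanced[of 0] by linarith
  then have \<kappa>: "0 < \<kappa>" "\<kappa> < 1" using l0_pos by (auto simp: \<kappa>_def)
  \<comment> \<open>With \<open>v = (w + 1) ^ 3\<close>, the factor \<open>n + 1\<close> costs
    \<open>v\<close> and each of the \<open>j + 2\<close> factors \<open>sd\<close> costs
    \<open>v\<^sup>2\<close>, hence \<open>v ^ (2 * j + 5)\<close>.\<close>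
  obtain K where K: "\<And>w::nat. (real w + 1) ^ (6 * j + 15) * \<kappa> ^ (w - 2) \<le> K"
    using poly_times_power_bounded[OF \<kappa>, of "6 * j + 15"] by blast
  have K0: "0 \<le> K" using order.trans[OF _ K[of 0]] by simp
  have "norm (qval (a i) (b i) (cis (2 * \<theta>))) / B i * (pi * sd i) ^ j * (1 + (pi * sd i)\<^sup>2) \<le> 4 ^ j * 17 * K"
    if \<theta>: "pi / n i \<le> \<bar>\<theta>\<bar>" "\<bar>\<theta>\<bar> \<le> pi / 2" for i \<theta>
  proof -
    have "a i + b i > 0" using a_pos[of i] by simp
    from ex_floor_cube_root[OF this]
    obtain w where w: "w \<ge> 1" "w ^ 3 \<le> a i + b i" "a i + b i < (w + 1) ^ 3"
      by (elim exE conjE) (rule that)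
    define v where "v = (real w + 1) ^ 3"
    have v1: "v \<ge> 1" by (simp add: v_def)
    have "real (a i + b i + 1) \<le> real ((w + 1) ^ 3)" using w(3) by (intro of_nat_mono) simp
    then have nv: "n i + 1 \<le> v" by (simp add: n_def v_def add_ac)
    have "norm (qval (a i) (b i) (cis (2 * \<theta>))) \<le> (real (a i + b i) + 1) * B i * \<kappa> ^ (w - 2)"
      unfolding B_def \<kappa>_def using \<theta> w a_pos b_pos l0_pos balanced
      by (intro norm_qval_middle_le) (auto simp: n_def)
    also have "\<dots> = (n i + 1) * \<kappa> ^ (w - 2) * B i" by (simp add: n_def)
    finally have 1: "norm (qval (a i) (b i) (cis (2 * \<theta>))) / B i \<le> (n i + 1) * \<kappa> ^ (w - 2)"
      using B_pos[of i] by (simp add: pos_divide_le_eq)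
    also have "\<dots> \<le> v * \<kappa> ^ (w - 2)" using nv \<kappa> by (intro mult_right_mono) auto
    finally have 1: "norm (qval (a i) (b i) (cis (2 * \<theta>))) / B i \<le> v * \<kappa> ^ (w - 2)" .
    have "sd i \<le> (n i)\<^sup>2" unfolding sd_def n_def by (rule gauss_sd_le[OF a_pos b_pos])
    also have "\<dots> \<le> v\<^sup>2" using nv n_pos[of i] by (intro power_mono) auto
    finally have 2: "pi * sd i \<le> 4 * v\<^sup>2"
      using pi_less_4 sd_pos[of i] by (intro mult_mono) auto
    have v4: "1 \<le> v ^ 4" using v1 by simp
    have "(pi * sd i)\<^sup>2 \<le> (4 * v\<^sup>2)\<^sup>2" using 2 sd_pos[of i] by (intro power_mono) auto
    then have 3: "1 + (pi * sd i)\<^sup>2 \<le> 17 * v ^ 4" using v4 by (simp add: power_mult_distrib)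
    have "norm (qval (a i) (b i) (cis (2 * \<theta>))) / B i * (pi * sd i) ^ j * (1 + (pi * sd i)\<^sup>2)
      \<le> (v * \<kappa> ^ (w - 2)) * (4 * v\<^sup>2) ^ j * (17 * v ^ 4)"
      by (rule mult_mono[OF mult_mono[OF 1 power_mono[OF 2]] 3])
        (use sd_pos[of i] B_pos[of i] v1 \<kappa> in \<open>auto intro!: mult_nonneg_nonneg simp: less_imp_le\<close>)
    also have "\<dots> = 4 ^ j * 17 * (v ^ (2 * j + 5) * \<kappa> ^ (w - 2))"
      by (simp add: power_mult_distrib power_add power_mult power4_eq_xxxx power_numeral_reduce)
    also have "v ^ (2 * j + 5) = (real w + 1) ^ (6 * j + 15)"
      by (simp add: v_def flip: power_mult)
    also have "4 ^ j * 17 * ((real w + 1) ^ (6 * j + 15) * \<kappa> ^ (w - 2)) \<le> 4 ^ j * 17 * K"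
      using K[of w] by (intro mult_left_mono) auto
    finally show ?thesis .
  qed
  then show ?thesis using K0 by (intro exI[of _ "4 ^ j * 17 * K"]) auto
qed

text \<open>The phase in \<open>qval_cis_eq\<close> is exactly that of the mean
  \<open>a * b / 2\<close>, so centring leaves a real product of sines, squeezed between
  \<open>sin_prod_ge\<close> and \<open>sin_prod_le\<close>.\<close>

lemma centered_qval_tendsto:
  "(\<lambda>i. cis (- (gauss_mean (a i) (b i) * s / sd i)) * (qval (a i) (b i) (cis (s / sd i)) / of_real (B i)))
     \<longlonglongrightarrow> of_real (exp (- s\<^sup>2 / 2))"
proof (cases "s = 0")
  case True
  have "qval (a i) (b i) 1 = of_real (B i)" for i
    unfolding qval_eq_sum B_def poly_qbin_1[symmetric] poly_eq_sum_atMost[OF degree_qbin] by simp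
  then show ?thesis using True B_pos by (simp add: less_imp_neq[symmetric])
next
  case False
  define \<theta> where "\<theta> = (\<lambda>i. \<bar>s\<bar> / (2 * sd i))"
  define S where "S = (\<lambda>i. (\<Prod>k=1..a i. sin (real (b i + k) * \<theta> i) / sin (real k * \<theta> i)) / B i)"
  have \<theta>: "\<theta> i > 0" for i using False sd_pos[of i] by (simp add: \<theta>_def)
  have n\<theta>: "n i * \<theta> i = \<bar>s\<bar> / 2 * (n i / sd i)" for i by (simp add: \<theta>_def)
  have "(\<lambda>i. n i * \<theta> i) \<longlonglongrightarrow> \<bar>s\<bar> / 2 * 0" unfolding n\<theta> by (intro tendsto_intros n_div_sd)
  then have ev: "\<forall>\<^sub>F i in sequentially. n i * \<theta> i < 1" by (intro order_tendstoD) auto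
  have expo: "- (\<theta> i)\<^sup>2 * (real (a i) * real (b i) * (real (a i) + real (b i) + 1)) / 6 = - s\<^sup>2 / 2" for i
  proof -
    have "real (a i) * real (b i) * (real (a i) + real (b i) + 1) = 12 * (sd i)\<^sup>2"
      by (simp add: sd_def gauss_sd_sq)
    then show ?thesis using sd_pos[of i] by (simp add: \<theta>_def power_divide power_mult_distrib)
  qed
  have eq: "\<forall>\<^sub>F i in sequentially. of_real (S i) =
      cis (- (gauss_mean (a i) (b i) * s / sd i)) * (qval (a i) (b i) (cis (s / sd i)) / of_real (B i))"
    using ev
  proof eventually_elim
    case (elim i)
    have abs: "\<bar>s / (2 * sd i)\<bar> = \<theta> i" using sd_pos[of i] by (simp add: \<theta>_def)
    have lt: "real (a i) * \<theta> i < pi" "real (b i) * \<theta> i < pi"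
      using elim \<theta>[of i] a_pos[of i] b_pos[of i] pi_gt3
      by (simp_all add: n_def distrib_right) (smt (verit) mult_nonneg_nonneg of_nat_0_le_iff)+
    have "qval (a i) (b i) (cis (2 * (s / (2 * sd i)))) = cis (real (a i * b i) * (s / (2 * sd i))) *
       of_real (\<Prod>k=1..a i. sin (real (b i + k) * \<bar>s / (2 * sd i)\<bar>) / sin (real k * \<bar>s / (2 * sd i)\<bar>))"
    proof (rule qval_cis_eq)
      show "s / (2 * sd i) \<noteq> 0" using False sd_pos[of i] by simp
    qed (use lt in \<open>simp_all only: abs\<close>)
    then have "qval (a i) (b i) (cis (s / sd i)) / of_real (B i) = cis (gauss_mean (a i) (b i) * s / sd i) * of_real (S i)"
      unfolding abs by (simp add: S_def gauss_mean_def)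
    then show ?case by (simp add: cis_mult flip: mult.assoc)
  qed
  have "S \<longlonglongrightarrow> exp (- s\<^sup>2 / 2)"
  proof (rule tendsto_sandwich[OF _ _ _ tendsto_const])
    have ev': "\<forall>\<^sub>F i in sequentially. real (a i + b i) * \<theta> i \<le> 1"
      using ev by eventually_elim (simp add: n_def)
    show "\<forall>\<^sub>F i in sequentially. S i \<le> exp (- s\<^sup>2 / 2)"
      using ev'
    proof eventually_elim
      case (elim i)
      then have "real (a i + b i) * \<theta> i \<le> pi" using pi_gt3 by linarith
      from sin_prod_le[OF \<theta> this b_pos] show ?case
        unfolding expo S_def using B_pos[of i]
        by (simp add: B_def[symmetric] pos_divide_le_eq mult.commute)
    qed
    \<comment> \<open>The error \<open>a * (n * \<theta>) ^ 4\<close> is of order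
      \<open>n * (n / sd) ^ 4\<close>, and \<open>(n / sd)\<^sup>2 \<le> 12 / l0 / n\<close> makes
      this of order \<open>1 / n\<close>.\<close>
    show "\<forall>\<^sub>F i in sequentially. exp (- s\<^sup>2 / 2 - 12 / l0 * (s ^ 4 / 16) * (12 / l0 / n i)) \<le> S i"
      using ev'
    proof eventually_elim
      case (elim i)
      have "real (a i) * (real (a i + b i) * \<theta> i) ^ 4 \<le> n i * (n i * \<theta> i) ^ 4"
        using \<theta>[of i] by (intro mult_mono) (auto simp: n_def)
      also have "\<dots> = s ^ 4 / 16 * n i * ((n i / sd i)\<^sup>2)\<^sup>2"
        unfolding n\<theta> by (simp add: power_mult_distrib power_divide)
      also have "\<dots> \<le> s ^ 4 / 16 * n i * (12 / l0 / n i)\<^sup>2"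
        using n_div_sd_sq_le[of i] n_pos[of i] by (intro mult_left_mono power_mono) auto
      also have "\<dots> = 12 / l0 * (s ^ 4 / 16) * (12 / l0 / n i)"
        using n_pos[of i] by (simp add: power2_eq_square)
      finally have *: "real (a i) * (real (a i + b i) * \<theta> i) ^ 4 \<le> \<dots>" .
      have "B i * exp (- s\<^sup>2 / 2 - 12 / l0 * (s ^ 4 / 16) * (12 / l0 / n i)) \<le>
            B i * exp (- s\<^sup>2 / 2 - real (a i) * (real (a i + b i) * \<theta> i) ^ 4)"
        using * B_pos[of i] by (intro mult_left_mono) auto
      also have "\<dots> \<le> (\<Prod>k=1..a i. sin (real (b i + k) * \<theta> i) / sin (real k * \<theta> i))"
        using sin_prod_ge[OF \<theta> elim b_pos] unfolding expo B_def .
      finally show ?case using B_pos[of i] by (simp add: S_def pos_le_divide_eq mult.commute)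
    qed
    have "(\<lambda>i. 12 / l0 / n i) \<longlonglongrightarrow> 0"
      by (rule tendsto_divide_0[OF tendsto_const filterlim_at_top_imp_at_infinity[OF n_top]])
    then have "(\<lambda>i. exp (- s\<^sup>2 / 2 - 12 / l0 * (s ^ 4 / 16) * (12 / l0 / n i))) \<longlonglongrightarrow>
       exp (- s\<^sup>2 / 2 - 12 / l0 * (s ^ 4 / 16) * 0)"
      by (intro tendsto_intros)
    then show "(\<lambda>i. exp (- s\<^sup>2 / 2 - 12 / l0 * (s ^ 4 / 16) * (12 / l0 / n i))) \<longlonglongrightarrow> exp (- s\<^sup>2 / 2)"
      by simp
  qed
  then have "(\<lambda>i. complex_of_real (S i)) \<longlonglongrightarrow> of_real (exp (- s\<^sup>2 / 2))" by (rule tendsto_of_real)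
  from Lim_transform_eventually[OF this eq] show ?thesis .
qed

text \<open>Under \<open>s = t * sd i\<close> each factor \<open>cis (- t) - 1\<close> absorbs one
  power of \<open>sd i\<close> and the change of variable absorbs one more, hence the exponent
  \<open>Suc j\<close>.\<close>

theorem local_limit:
  fixes m :: "nat \<Rightarrow> int"
  assumes x: "(\<lambda>i. (real_of_int (m i) - gauss_mean (a i) (b i)) / sd i) \<longlonglongrightarrow> x"
  shows "(\<lambda>i. complex_of_real (sd i ^ Suc j * (fdiff ^^ j) (gauss_prob (a i) (b i)) (m i))) \<longlonglongrightarrow> gauss_jet j x"
proof -
  define P where "P = (\<lambda>i t. qval (a i) (b i) (cis t) / of_real (B i))"
  define H where "H = (\<lambda>i s. indicator {-pi..pi} (s / sd i) *\<^sub>R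
     ((of_real (sd i) * (cis (- (s / sd i)) - 1)) ^ j * cis (- (real_of_int (m i) * (s / sd i))) * P i (s / sd i)))"
  define G where "G = (\<lambda>s. (- \<i> * of_real s) ^ j * cis (- (x * s)) * complex_of_real (exp (- s\<^sup>2 / 2)))"
  have eq: "complex_of_real (sd i ^ Suc j * (fdiff ^^ j) (gauss_prob (a i) (b i)) (m i)) =
      1 / (2 * of_real pi) * integral\<^sup>L lborel (H i)" for i
  proof -
    define f where "f = (\<lambda>t. indicator {-pi..pi} t *\<^sub>R ((cis (- t) - 1) ^ j * cis (- (real_of_int (m i) * t)) * P i t))"
    have "integral\<^sup>L lborel f = (1 / sd i) *\<^sub>R (\<integral>s. f (s / sd i) \<partial>lborel)"
      using lborel_integral_real_affine[of "1 / sd i" f 0] sd_pos[of i] by simp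
    then have "of_real (sd i) * integral\<^sup>L lborel f = (\<integral>s. f (s / sd i) \<partial>lborel)"
      using sd_pos[of i] by (simp add: scaleR_conv_of_real)
    then have "of_real (sd i ^ Suc j) * integral\<^sup>L lborel f = of_real (sd i ^ j) * (\<integral>s. f (s / sd i) \<partial>lborel)"
      by (simp add: mult_ac)
    also have "\<dots> = (\<integral>s. of_real (sd i ^ j) * f (s / sd i) \<partial>lborel)" by simp
    also have "(\<lambda>s. of_real (sd i ^ j) * f (s / sd i)) = H i"
      by (simp add: fun_eq_iff f_def H_def power_mult_distrib mult_ac)
    finally show ?thesis
      using gauss_prob_fourier[of j "a i" "b i" "m i"]
      by (simp add: f_def P_def B_def mult_ac)
  qed
  obtain C where C: "C \<ge> 0" "\<And>i \<theta>. pi / n i \<le> \<bar>\<theta>\<bar> \<Longrightarrow> \<bar>\<theta>\<bar> \<le> pi / 2 \<Longrightarrow>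
    norm (qval (a i) (b i) (cis (2 * \<theta>))) / B i * (pi * sd i) ^ j * (1 + (pi * sd i)\<^sup>2) \<le> C"
    using tail_bound[of j] by blast
  \<comment> \<open>The first summand dominates the central range, the second the rest up to
    \<open>\<bar>t\<bar> = pi\<close>.\<close>
  define D where "D = (\<lambda>s::real. \<bar>s\<bar> ^ j * exp (- s\<^sup>2 / 2) + C * inverse (1 + s\<^sup>2))"
  have bound: "norm (H i s) \<le> D s" for i s
  proof (cases "\<bar>s / sd i\<bar> \<le> pi")
    case False
    then have "s / sd i \<notin> {-pi..pi}" unfolding atLeastAtMost_iff by linarith
    then have "H i s = 0" by (simp add: H_def)
    then show ?thesis using C(1) by (simp add: D_def)
  next
    case True
    define \<theta> where "\<theta> = s / (2 * sd i)"
    have s: "s = 2 * \<theta> * sd i" "s / sd i = 2 * \<theta>" using sd_pos[of i] by (simp_all add: \<theta>_def)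
    have 1: "norm (of_real (sd i) * (cis (- (s / sd i)) - 1)) \<le> \<bar>s\<bar>"
    proof -
      have "sd i * norm (cis (- (s / sd i)) - 1) \<le> sd i * \<bar>s / sd i\<bar>"
        using norm_cis_minus_1_le[of "- (s / sd i)"] sd_pos[of i] by (intro mult_left_mono) auto
      then show ?thesis using sd_pos[of i] by (simp add: norm_mult)
    qed
    have "norm (H i s) \<le> norm (of_real (sd i) * (cis (- (s / sd i)) - 1)) ^ j * norm (P i (s / sd i))"
      by (simp add: H_def norm_mult norm_power indicator_def)
    also have "\<dots> \<le> \<bar>s\<bar> ^ j * norm (P i (s / sd i))"
      by (intro mult_right_mono power_mono 1) auto
    finally have 2: "norm (H i s) \<le> \<bar>s\<bar> ^ j * norm (P i (s / sd i))" .
    have P: "norm (P i (s / sd i)) = norm (qval (a i) (b i) (cis (2 * \<theta>))) / B i"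
      unfolding P_def s(2) using B_pos[of i] by (simp add: norm_divide)
    show ?thesis
    proof (cases "n i * \<bar>\<theta>\<bar> \<le> pi")
      case True
      then have "real (a i + b i) * \<bar>\<theta>\<bar> \<le> pi" by (simp add: n_def)
      from norm_qval_central_le[OF a_pos b_pos this]
      have "norm (P i (s / sd i)) \<le> exp (- s\<^sup>2 / 2)"
        unfolding P B_def[symmetric] sd_def[symmetric] s(1)[symmetric] .
      from mult_left_mono[OF this, of "\<bar>s\<bar> ^ j"] 2 C(1) show ?thesis
        unfolding D_def by (smt (verit) zero_le_power abs_ge_zero mult_nonneg_nonneg inverse_nonnegative_iff_nonnegative zero_le_power2)
    next
      case False
      have \<theta>: "pi / n i \<le> \<bar>\<theta>\<bar>" "\<bar>\<theta>\<bar> \<le> pi / 2"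
        using False True n_pos[of i] sd_pos[of i] by (auto simp: s(2) field_simps abs_mult)
      have sle: "\<bar>s\<bar> \<le> pi * sd i" using True sd_pos[of i] by (simp add: field_simps)
      have "\<bar>s\<bar> ^ j * norm (P i (s / sd i)) * (1 + s\<^sup>2) \<le> norm (P i (s / sd i)) * (pi * sd i) ^ j * (1 + (pi * sd i)\<^sup>2)"
      proof -
        have "s\<^sup>2 \<le> (pi * sd i)\<^sup>2" using sle power_mono[OF sle, of 2] by simp
        then show ?thesis using sle sd_pos[of i]
          by (subst mult.commute[of "\<bar>s\<bar> ^ j"], intro mult_mono power_mono) auto
      qed
      also have "\<dots> \<le> C" unfolding P by (rule C(2)[OF \<theta>])
      finally have "\<bar>s\<bar> ^ j * norm (P i (s / sd i)) \<le> C * inverse (1 + s\<^sup>2)"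
        by (simp add: field_simps add_pos_nonneg)
      with 2 show ?thesis unfolding D_def by (smt (verit) zero_le_power abs_ge_zero mult_nonneg_nonneg exp_ge_zero)
    qed
  qed
  have intD: "integrable lborel D"
  proof -
    have "integrable lborel (\<lambda>s::real. inverse (1 + s\<^sup>2))"
      using integrable_inverse_1_plus_square by (simp add: set_integrable_def)
    then show ?thesis unfolding D_def
      by (intro Bochner_Integration.integrable_add integrable_mult_right integrable_power_gauss)
  qed
  have lim: "(\<lambda>i. H i s) \<longlonglongrightarrow> G s" for s
  proof -
    define M where "M = (\<lambda>i. (real_of_int (m i) - gauss_mean (a i) (b i)) / sd i)"
    define Q where "Q = (\<lambda>i. cis (- (gauss_mean (a i) (b i) * s / sd i)) * P i (s / sd i))"
    have "(\<lambda>i. s / sd i) \<longlonglongrightarrow> 0"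
      by (rule tendsto_divide_0[OF tendsto_const filterlim_at_top_imp_at_infinity[OF sd_top]])
    then have "\<forall>\<^sub>F i in sequentially. norm (s / sd i) < pi"
      by (rule order_tendstoD(2)[OF tendsto_norm_zero pi_gt_zero])
    then have ev: "\<forall>\<^sub>F i in sequentially. (of_real (sd i) * (cis (- (s / sd i)) - 1)) ^ j * cis (- (M i * s)) * Q i = H i s"
    proof eventually_elim
      case (elim i)
      have "- (M i * s) + - (gauss_mean (a i) (b i) * s / sd i) = - (real_of_int (m i) * (s / sd i))"
        using sd_pos[of i] by (simp add: M_def field_simps)
      then have "cis (- (M i * s)) * cis (- (gauss_mean (a i) (b i) * s / sd i)) = cis (- (real_of_int (m i) * (s / sd i)))"
        by (simp only: cis_mult)
      moreover have "s / sd i \<in> {-pi..pi}"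
        using elim unfolding atLeastAtMost_iff real_norm_def by linarith
      ultimately show ?case by (simp add: H_def Q_def flip: mult.assoc)
    qed
    have "(\<lambda>i. (of_real (sd i) * (cis (- (s / sd i)) - 1)) ^ j * cis (- (M i * s)) * Q i) \<longlonglongrightarrow> G s"
      unfolding G_def
    proof (rule tendsto_mult[OF tendsto_mult[OF tendsto_power[OF tendsto_scaled_cis_minus_1[OF sd_top]]]])
      have "isCont (\<lambda>y. cis (- (y * s))) x"
        by (rule continuous_on_interior[of UNIV]) (auto intro!: continuous_intros)
      from isCont_tendsto_compose[OF this x]
      show "(\<lambda>i. cis (- (M i * s))) \<longlonglongrightarrow> cis (- (x * s))" by (simp add: M_def)
      show "Q \<longlonglongrightarrow> of_real (exp (- s\<^sup>2 / 2))"
        using centered_qval_tendsto[of s] by (simp add: Q_def P_def)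
    qed
    from Lim_transform_eventually[OF this ev] show ?thesis .
  qed
  have measG: "G \<in> borel_measurable lborel"
    unfolding G_def by (rule borel_measurable_integrable[OF integrable_gauss_jet])
  have measH: "H i \<in> borel_measurable lborel" for i
  proof -
    have "continuous_on UNIV (\<lambda>t. (of_real (sd i) * (cis (- t) - 1)) ^ j * cis (- (real_of_int (m i) * t)) * P i t)"
      unfolding P_def using B_pos[of i] by (intro continuous_intros) auto
    then have "(\<lambda>t. (of_real (sd i) * (cis (- t) - 1)) ^ j * cis (- (real_of_int (m i) * t)) * P i t) \<in> borel_measurable borel"
      by (rule borel_measurable_continuous_onI)
    then have "(\<lambda>t. indicator {-pi..pi} t *\<^sub>R ((of_real (sd i) * (cis (- t) - 1)) ^ j * cis (- (real_of_int (m i) * t)) * P i t)) \<in> borel_measurable borel"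
      by (intro borel_measurable_scaleR borel_measurable_indicator) auto
    from measurable_compose[OF _ this, of "\<lambda>s. s / sd i" lborel] show ?thesis
      by (simp add: H_def)
  qed
  have "(\<lambda>i. integral\<^sup>L lborel (H i)) \<longlonglongrightarrow> integral\<^sup>L lborel G"
    by (rule integral_dominated_convergence[OF measG measH intD]) (use lim bound in auto)
  then have "(\<lambda>i. 1 / (2 * of_real pi) * integral\<^sup>L lborel (H i)) \<longlonglongrightarrow> 1 / (2 * of_real pi) * integral\<^sup>L lborel G"
    by (intro tendsto_intros)
  then show ?thesis unfolding eq by (simp add: gauss_jet_def G_def)
qed

end

section \<open>Jets of sequences\<close>

lemma funpow_fdiff_add: "(fdiff ^^ j) (\<lambda>k. u k + v k) = (\<lambda>k. (fdiff ^^ j) u k + (fdiff ^^ j) v k)"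
  by (induction j) (auto simp: fdiff_def)

lemma funpow_fdiff_cmult: "(fdiff ^^ j) (\<lambda>k. c * u k) = (\<lambda>k. c * (fdiff ^^ j) u k)"
  by (induction j) (auto simp: fdiff_def algebra_simps)

lemma funpow_fdiff_shift: "(fdiff ^^ j) (\<lambda>k. u (k + c)) = (\<lambda>k. (fdiff ^^ j) u (k + c))"
  by (induction j) (auto simp: fdiff_def add_ac)

lemma funpow_fps_deriv_add: "(fps_deriv ^^ j) (F + G) = (fps_deriv ^^ j) F + (fps_deriv ^^ j) (G :: real fps)"
  by (induction j) auto

lemma funpow_fps_deriv_cmult: "(fps_deriv ^^ j) (fps_const c * F) = fps_const c * (fps_deriv ^^ j) (F :: real fps)"
  by (induction j) auto

lemma funpow_fps_deriv_nth_0: "fps_nth ((fps_deriv ^^ j) F) 0 = fact j * fps_nth (F :: real fps) j"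
  by (induction j arbitrary: F) (simp_all add: funpow_Suc_right algebra_simps del: funpow.simps)

text \<open>The series \<open>F\<close> collects the Taylor coefficients, at the limit point, of the limit function.
  Quantifying over the offset \<open>h\<close> makes the notion invariant under shifts, which the discrete
  Leibniz rule needs.\<close>

definition diff_limit ::
  "(nat \<Rightarrow> real) \<Rightarrow> (nat \<Rightarrow> int) \<Rightarrow> nat \<Rightarrow> (nat \<Rightarrow> int \<Rightarrow> real) \<Rightarrow> real fps \<Rightarrow> bool" where
  "diff_limit \<sigma> m j u F \<longleftrightarrow>
     (\<forall>h. (\<lambda>i. \<sigma> i ^ j * (fdiff ^^ j) (u i) (m i + h)) \<longlonglongrightarrow> fps_nth ((fps_deriv ^^ j) F) 0)"

definition jet_limit ::
  "(nat \<Rightarrow> real) \<Rightarrow> (nat \<Rightarrow> int) \<Rightarrow> (nat \<Rightarrow> int \<Rightarrow> real) \<Rightarrow> real fps \<Rightarrow> bool" where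
  "jet_limit \<sigma> m u F \<longleftrightarrow> (\<forall>j. diff_limit \<sigma> m j u F)"

lemma diff_limit_Suc:
  "diff_limit \<sigma> m (Suc j) u F \<longleftrightarrow> diff_limit \<sigma> m j (\<lambda>i k. \<sigma> i * fdiff (u i) k) (fps_deriv F)"
  unfolding diff_limit_def funpow_Suc_right o_apply funpow_fdiff_cmult by (simp add: mult_ac)

lemma diff_limit_add:
  "diff_limit \<sigma> m j u F \<Longrightarrow> diff_limit \<sigma> m j v G \<Longrightarrow> diff_limit \<sigma> m j (\<lambda>i k. u i k + v i k) (F + G)"
  unfolding diff_limit_def funpow_fdiff_add funpow_fps_deriv_add
  by (auto simp: distrib_left intro!: tendsto_add)

lemma diff_limit_cmult:
  "diff_limit \<sigma> m j u F \<Longrightarrow> diff_limit \<sigma> m j (\<lambda>i k. c * u i k) (fps_const c * F)"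
  unfolding diff_limit_def funpow_fdiff_cmult funpow_fps_deriv_cmult
  by (auto simp: mult.left_commute[of _ c] intro!: tendsto_mult_left)

lemma diff_limit_shift:
  "diff_limit \<sigma> m j u F \<Longrightarrow> diff_limit \<sigma> m j (\<lambda>i k. u i (k + c)) F"
  unfolding diff_limit_def funpow_fdiff_shift by (auto simp: add.assoc)

text \<open>The Leibniz rule for differences: the difference of \<open>u * v\<close> at
  \<open>k\<close> is \<open>u k\<close> times that of \<open>v\<close> plus that of
  \<open>u\<close> times \<open>v (k + 1)\<close>. This lowers the order by one, but mixes
  differences of all smaller orders, so the hypotheses cover every
  \<open>j' \<le> j\<close>.\<close>

lemma diff_limit_mult:
  assumes "\<And>j'. j' \<le> j \<Longrightarrow> diff_limit \<sigma> m j' u F" "\<And>j'. j' \<le> j \<Longrightarrow> diff_limit \<sigma> m j' v G"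
  shows "diff_limit \<sigma> m j (\<lambda>i k. u i k * v i k) (F * G)"
  using assms
proof (induction j arbitrary: u v F G)
  case 0
  then show ?case by (auto simp: diff_limit_def intro!: tendsto_mult)
next
  case (Suc j)
  have "diff_limit \<sigma> m j' (\<lambda>i k. \<sigma> i * fdiff (u i) k) (fps_deriv F)" if "j' \<le> j" for j'
    using Suc.prems(1)[of "Suc j'"] that by (simp add: diff_limit_Suc)
  then have 1: "diff_limit \<sigma> m j (\<lambda>i k. \<sigma> i * fdiff (u i) k * v i (k + 1)) (fps_deriv F * G)"
    using Suc.prems(2) by (intro Suc.IH diff_limit_shift) auto
  have "diff_limit \<sigma> m j' (\<lambda>i k. \<sigma> i * fdiff (v i) k) (fps_deriv G)" if "j' \<le> j" for j'
    using Suc.prems(2)[of "Suc j'"] that by (simp add: diff_limit_Suc)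
  then have 2: "diff_limit \<sigma> m j (\<lambda>i k. u i k * (\<sigma> i * fdiff (v i) k)) (F * fps_deriv G)"
    using Suc.prems(1) by (intro Suc.IH) auto
  have "(\<lambda>i k. \<sigma> i * fdiff (\<lambda>k. u i k * v i k) k) =
     (\<lambda>i k. u i k * (\<sigma> i * fdiff (v i) k) + \<sigma> i * fdiff (u i) k * v i (k + 1))"
    by (simp add: fun_eq_iff fdiff_def algebra_simps)
  with diff_limit_add[OF 2 1] show ?case
    by (simp add: diff_limit_Suc)
qed

lemma jet_limit_diff: "jet_limit \<sigma> m u F \<Longrightarrow> jet_limit \<sigma> m (\<lambda>i k. \<sigma> i * fdiff (u i) k) (fps_deriv F)"
  by (simp add: jet_limit_def flip: diff_limit_Suc)

lemma jet_limit_add: "jet_limit \<sigma> m u F \<Longrightarrow> jet_limit \<sigma> m v G \<Longrightarrow> jet_limit \<sigma> m (\<lambda>i k. u i k + v i k) (F + G)"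
  by (simp add: jet_limit_def diff_limit_add)

lemma jet_limit_cmult: "jet_limit \<sigma> m u F \<Longrightarrow> jet_limit \<sigma> m (\<lambda>i k. c * u i k) (fps_const c * F)"
  by (simp add: jet_limit_def diff_limit_cmult)

lemma jet_limit_shift: "jet_limit \<sigma> m u F \<Longrightarrow> jet_limit \<sigma> m (\<lambda>i k. u i (k + c)) F"
  by (simp add: jet_limit_def diff_limit_shift)

lemma jet_limit_mult: "jet_limit \<sigma> m u F \<Longrightarrow> jet_limit \<sigma> m v G \<Longrightarrow> jet_limit \<sigma> m (\<lambda>i k. u i k * v i k) (F * G)"
  by (simp add: jet_limit_def diff_limit_mult)

lemma jet_limitD: "jet_limit \<sigma> m u F \<Longrightarrow> (\<lambda>i. u i (m i)) \<longlonglongrightarrow> fps_nth F 0"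
  unfolding jet_limit_def diff_limit_def by (drule spec[of _ 0], drule spec[of _ 0]) simp

section \<open>The Turan operator, its iterates and their limits\<close>

definition turan :: "(int \<Rightarrow> real) \<Rightarrow> int \<Rightarrow> real" where
  "turan u k = (u k)\<^sup>2 - u (k - 1) * u (k + 1)"

lemma turan_cmult: "turan (\<lambda>k. c * u k) = (\<lambda>k. c\<^sup>2 * turan u k)"
  by (auto simp: turan_def algebra_simps power2_eq_square)

lemma L_op_outside: "k < 0 \<or> k > int N \<Longrightarrow> L_op N u k = 0"
  by (auto simp: L_op_def zero_ext_def)

lemma L_op_eq_turan:
  assumes "\<And>k. k < 0 \<or> k > int N \<Longrightarrow> u k = 0"
  shows "L_op N u = turan u"
proof -
  have "zero_ext N u = u" using assms by (force simp: zero_ext_def fun_eq_iff)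
  then show ?thesis by (simp add: fun_eq_iff L_op_def turan_def)
qed

text \<open>The sequence and, by \<open>L_op_outside\<close>, all iterates vanish outside
  \<open>{0..N}\<close>, so truncation changes nothing. The shift-invariant \<open>turan\<close> is
  the form to which the calculus of limits applies.\<close>

lemma funpow_L_op_eq_turan:
  assumes "\<And>k. k < 0 \<or> k > int N \<Longrightarrow> u k = 0"
  shows "(L_op N ^^ r) u = (turan ^^ r) u"
proof (induction r)
  case (Suc r)
  have "L_op N ((L_op N ^^ r) u) = turan ((L_op N ^^ r) u)"
    by (rule L_op_eq_turan) (cases r; simp add: assms L_op_outside)
  then show ?case using Suc by simp
qed simp

lemma jet_limit_turan:
  assumes "jet_limit \<sigma> m u F"
  shows "jet_limit \<sigma> m (\<lambda>i k. (\<sigma> i)\<^sup>2 * turan (u i) k) ((fps_deriv F)\<^sup>2 - F * fps_deriv (fps_deriv F))"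
proof -
  \<comment> \<open>Shifted so that \<open>turan u k\<close> is exactly the squared first difference
    of \<open>v\<close> minus \<open>v\<close> times its second difference, all at
    \<open>k\<close>.\<close>
  define v where "v = (\<lambda>i k. u i (k + (-1)))"
  define v1 where "v1 = (\<lambda>i k. \<sigma> i * fdiff (v i) k)"
  define v2 where "v2 = (\<lambda>i k. \<sigma> i * fdiff (v1 i) k)"
  have v: "jet_limit \<sigma> m v F" unfolding v_def by (rule jet_limit_shift[OF assms])
  have v1: "jet_limit \<sigma> m v1 (fps_deriv F)" unfolding v1_def by (rule jet_limit_diff[OF v])
  have v2: "jet_limit \<sigma> m v2 (fps_deriv (fps_deriv F))" unfolding v2_def by (rule jet_limit_diff[OF v1])
  have "jet_limit \<sigma> m (\<lambda>i k. v1 i k * v1 i k + (-1) * (v i k * v2 i k))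
     (fps_deriv F * fps_deriv F + fps_const (-1) * (F * fps_deriv (fps_deriv F)))"
    by (intro jet_limit_add jet_limit_cmult jet_limit_mult v v1 v2)
  also have "(\<lambda>i k. v1 i k * v1 i k + (-1) * (v i k * v2 i k)) = (\<lambda>i k. (\<sigma> i)\<^sup>2 * turan (u i) k)"
    by (simp add: fun_eq_iff v_def v1_def v2_def fdiff_def turan_def power2_eq_square algebra_simps)
  also have "fps_deriv F * fps_deriv F + fps_const (-1) * (F * fps_deriv (fps_deriv F)) =
      (fps_deriv F)\<^sup>2 - F * fps_deriv (fps_deriv F)"
    by (simp add: power2_eq_square flip: fps_const_neg)
  finally show ?thesis .
qed

text \<open>The equation says that \<open>F\<close> is the Taylor series at \<open>x\<close> of a multiple of \<open>\<lambda>t. exp (- \<alpha> t\<^sup>2 / 2)\<close>.\<close>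

definition gauss_ode :: "real \<Rightarrow> real \<Rightarrow> real fps \<Rightarrow> bool" where
  "gauss_ode \<alpha> x F \<longleftrightarrow> fps_deriv F = - (fps_const \<alpha> * ((fps_const x + fps_X) * F))"

text \<open>The left side is \<open>- F\<^sup>2\<close> times the second derivative of
  \<open>ln F\<close>, which is the constant \<open>- \<alpha>\<close> for a Gaussian; squaring
  doubles \<open>\<alpha>\<close>.\<close>

lemma gauss_ode_turan:
  assumes "gauss_ode \<alpha> x F"
  shows "(fps_deriv F)\<^sup>2 - F * fps_deriv (fps_deriv F) = fps_const \<alpha> * F\<^sup>2"
    and "gauss_ode (2 * \<alpha>) x (fps_const \<alpha> * F\<^sup>2)"
proof -
  define A where "A = fps_const \<alpha>"
  define Y where "Y = fps_const x + (fps_X :: real fps)"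
  have d: "fps_deriv F = - (A * (Y * F))" using assms by (simp add: gauss_ode_def A_def Y_def)
  have AY: "fps_deriv A = 0" "fps_deriv Y = 1" by (simp_all add: A_def Y_def)
  have "fps_deriv (fps_deriv F) = fps_deriv (- (A * (Y * F)))" by (simp only: d)
  then have dd: "fps_deriv (fps_deriv F) = - (A * (F + Y * fps_deriv F))"
    by (simp add: AY algebra_simps)
  show "(fps_deriv F)\<^sup>2 - F * fps_deriv (fps_deriv F) = fps_const \<alpha> * F\<^sup>2"
    unfolding dd A_def[symmetric] unfolding d by (simp add: power2_eq_square algebra_simps)
  have "fps_deriv (A * F\<^sup>2) = A * (F * fps_deriv F + fps_deriv F * F)"
    by (simp add: A_def power2_eq_square)
  also have "\<dots> = - ((A + A) * (Y * (A * F\<^sup>2)))"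
    unfolding d by (simp add: power2_eq_square algebra_simps)
  also have "A + A = fps_const (2 * \<alpha>)" by (simp add: A_def)
  finally show "gauss_ode (2 * \<alpha>) x (fps_const \<alpha> * F\<^sup>2)" by (simp add: gauss_ode_def A_def Y_def)
qed

text \<open>Scale and rate are existential because one step turns the scale \<open>s'\<close> into
  \<open>\<sigma>\<^sup>2 * s'\<^sup>2\<close> and doubles \<open>\<alpha>\<close>; only their
  positivity matters for the sign.\<close>

lemma jet_limit_funpow_turan:
  assumes "jet_limit \<sigma> m (\<lambda>i k. s i * u i k) F" "gauss_ode 1 x F" "fps_nth F 0 > 0"
    and "\<And>i. s i > 0" "\<And>i. \<sigma> i > 0"
  shows "\<exists>s' \<alpha> G. (\<forall>i. s' i > 0) \<and> jet_limit \<sigma> m (\<lambda>i k. s' i * (turan ^^ r) (u i) k) G \<and>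
    gauss_ode \<alpha> x G \<and> \<alpha> > 0 \<and> fps_nth G 0 > 0"
proof (induction r)
  case 0
  show ?case by (rule exI[of _ s], rule exI[of _ 1], rule exI[of _ F]) (use assms in simp)
next
  case (Suc r)
  then obtain s' \<alpha> G where G: "\<And>i. s' i > 0" "jet_limit \<sigma> m (\<lambda>i k. s' i * (turan ^^ r) (u i) k) G"
    "gauss_ode \<alpha> x G" "\<alpha> > 0" "fps_nth G 0 > 0" by auto
  from jet_limit_turan[OF G(2)]
  have "jet_limit \<sigma> m (\<lambda>i k. ((\<sigma> i)\<^sup>2 * (s' i)\<^sup>2) * (turan ^^ Suc r) (u i) k) (fps_const \<alpha> * G\<^sup>2)"
    by (simp add: turan_cmult gauss_ode_turan(1)[OF G(3)] mult.assoc)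
  then show ?case
    using gauss_ode_turan(2)[OF G(3)] G(1,4,5) assms(5)
    by (intro exI[of _ "\<lambda>i. (\<sigma> i)\<^sup>2 * (s' i)\<^sup>2"] exI[of _ "2 * \<alpha>"] exI[of _ "fps_const \<alpha> * G\<^sup>2"])
      (auto simp: power2_eq_square less_imp_neq[symmetric])
qed

section \<open>Hermite polynomials\<close>

text \<open>Up to scaling these are the Hermite polynomials.\<close>

primrec herm :: "nat \<Rightarrow> real poly" where
  "herm 0 = 1"
| "herm (Suc d) = [:0, 1:] * herm d - smult 2 (pderiv (herm d))"

lemma degree_herm: "degree (herm d) = d" and lead_coeff_herm: "coeff (herm d) d = 1"
proof -
  have "degree (herm d) = d \<and> coeff (herm d) d = 1"
  proof (induction d)
    case (Suc d)
    have lt: "degree (smult 2 (pderiv (herm d))) < Suc d"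
      using Suc degree_pderiv[of "herm d"] by simp
    have nz: "herm d \<noteq> 0" using Suc by auto
    have "degree ([:0, 1:] * herm d) = Suc d" using Suc nz by (simp add: degree_pCons_eq)
    then have "degree (herm (Suc d)) = Suc d"
      using lt degree_add_eq_left[of "- smult 2 (pderiv (herm d))" "[:0, 1:] * herm d"] by simp
    moreover have "coeff (smult 2 (pderiv (herm d))) (Suc d) = 0"
      using lt by (rule coeff_eq_0)
    then have "coeff (herm (Suc d)) (Suc d) = 1" using Suc by simp
    ultimately show ?case by blast
  qed simp
  then show "degree (herm d) = d" "coeff (herm d) d = 1" by auto
qed

text \<open>Parity, which carries the sign at plus infinity over to minus infinity.\<close>

lemma herm_reflect: "pcompose (herm d) [:0, -1:] = smult ((-1) ^ d) (herm d)"
proof (induction d)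
  case (Suc d)
  have "pderiv (smult ((-1) ^ d) (herm d)) = pderiv (pcompose (herm d) [:0, -1:])" by (simp only: Suc)
  then have "pcompose (pderiv (herm d)) [:0, -1:] = smult ((-1) ^ Suc d) (pderiv (herm d))"
    by (simp add: pderiv_pcompose pderiv_smult pderiv_pCons)
  then show ?case using Suc
    by (simp add: pcompose_diff pcompose_smult pcompose_pCons smult_diff_right mult.commute)
qed (simp add: pcompose_1)

lemma poly_herm_minus: "poly (herm d) (- t) = (-1) ^ d * poly (herm d) t"
  using arg_cong[OF herm_reflect, of "\<lambda>p. poly p t" d] by (simp add: poly_pcompose)

lemma herm_eventually_pos: "\<exists>n. \<forall>t\<ge>n. poly (herm d) t > 0"
proof -
  obtain n where "\<forall>t\<ge>n. lead_coeff (herm d) \<le> poly (herm d) t"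
    using poly_pinfty_gt_lc[of "herm d"] by (auto simp: degree_herm lead_coeff_herm)
  then show ?thesis by (intro exI[of _ n]) (auto simp: degree_herm lead_coeff_herm intro: less_le_trans[OF zero_less_one])
qed

text \<open>Encodes real simple roots by strict signs at \<open>d + 1\<close> points, the last one
  positive: unlike the roots themselves, finitely many strict signs visibly survive pointwise
  convergence.\<close>

definition alternates :: "nat \<Rightarrow> real poly \<Rightarrow> (nat \<Rightarrow> real) \<Rightarrow> bool" where
  "alternates d p y \<longleftrightarrow> (\<forall>i<d. y i < y (Suc i)) \<and> (\<forall>i\<le>d. (-1) ^ (d + i) * poly p (y i) > 0)"

text \<open>Rolle's argument for \<open>\<lambda>t. exp (- t\<^sup>2 / 4) * poly (herm d) t\<close>, whose derivative is a
  negative function times \<open>herm (Suc d)\<close>.\<close>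

lemma herm_alternates: "\<exists>y. alternates d (herm d) y"
proof (induction d)
  case 0
  show ?case by (rule exI[of _ "\<lambda>_. 0"]) (simp add: alternates_def)
next
  case (Suc d)
  then obtain y where y: "\<And>i. i < d \<Longrightarrow> y i < y (Suc i)" "\<And>i. i \<le> d \<Longrightarrow> (-1) ^ (d + i) * poly (herm d) (y i) > 0"
    by (auto simp: alternates_def)
  define w where "w = (\<lambda>t. exp (- t\<^sup>2 / 4) * poly (herm d) t)"
  have w': "(w has_real_derivative (- 1 / 2 * exp (- t\<^sup>2 / 4) * poly (herm (Suc d)) t)) (at t)" for t
    unfolding w_def by (rule derivative_eq_intros refl | simp)+ (simp add: field_simps)
  \<comment> \<open>\<open>w\<close> has opposite signs at the two ends, so the mean value theorem
    yields an interior point where the sign of its derivative is known.\<close>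
  have "\<exists>\<eta>. y i < \<eta> \<and> \<eta> < y (Suc i) \<and> (-1) ^ (d + i) * poly (herm (Suc d)) \<eta> > 0" if i: "i < d" for i
  proof -
    obtain \<eta> where \<eta>: "y i < \<eta>" "\<eta> < y (Suc i)"
      "w (y (Suc i)) - w (y i) = (y (Suc i) - y i) * (- 1 / 2 * exp (- \<eta>\<^sup>2 / 4) * poly (herm (Suc d)) \<eta>)"
      using MVT2[OF y(1)[OF i] w'] by blast
    have "(-1) ^ (d + i) * w (y i) > 0"
      using y(2)[of i] i by (simp add: w_def mult.left_commute[of _ "exp _"])
    moreover have "(-1) ^ (d + Suc i) * w (y (Suc i)) > 0"
      using mult_pos_pos[OF exp_gt_zero[of "- (y (Suc i))\<^sup>2 / 4"] y(2)[of "Suc i"]] i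
      by (simp add: w_def mult_ac)
    ultimately have "(-1) ^ (d + i) * (w (y (Suc i)) - w (y i)) < 0"
      by (simp add: right_diff_distrib)
    then have "(y (Suc i) - y i) * (1 / 2 * exp (- \<eta>\<^sup>2 / 4)) * ((-1) ^ (d + i) * poly (herm (Suc d)) \<eta>) > 0"
      unfolding \<eta>(3) by (simp add: mult_ac)
    moreover have "(y (Suc i) - y i) * (1 / 2 * exp (- \<eta>\<^sup>2 / 4)) > 0" using y(1)[OF i] by simp
    ultimately show ?thesis using \<eta> zero_less_mult_pos by blast
  qed
  then obtain \<eta> where \<eta>: "\<And>i. i < d \<Longrightarrow> y i < \<eta> i" "\<And>i. i < d \<Longrightarrow> \<eta> i < y (Suc i)"
    "\<And>i. i < d \<Longrightarrow> (-1) ^ (d + i) * poly (herm (Suc d)) (\<eta> i) > 0" by metis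
  obtain M where M: "\<And>t. t \<ge> M \<Longrightarrow> poly (herm (Suc d)) t > 0"
    using herm_eventually_pos[of "Suc d"] by blast
  \<comment> \<open>One more point on either side, far enough out for the leading term to decide the
    sign; with the \<open>d\<close> interior points this makes \<open>d + 2\<close>.\<close>
  define R where "R = max M (y d + 1)"
  define L where "L = - max M (1 - y 0)"
  have R: "y d < R" "poly (herm (Suc d)) R > 0" using M[of R] by (auto simp: R_def simp del: herm.simps)
  have L: "L < y 0" "(-1) ^ Suc d * poly (herm (Suc d)) L > 0"
    using M[of "- L"] poly_herm_minus[of "Suc d" L] by (auto simp: L_def simp del: herm.simps)
  define y' where "y' = (\<lambda>i. if i = 0 then L else if i \<le> d then \<eta> (i - 1) else R)"
  have "y' i < y' (Suc i)" if "i < Suc d" for i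
  proof (cases i)
    case 0
    then show ?thesis using L(1) R(1) \<eta>(1)[of 0] by (cases "d = 0") (auto simp: y'_def)
  next
    case (Suc k)
    show ?thesis
    proof (cases "Suc k < d")
      case True
      then show ?thesis using \<eta>(2)[of k] \<eta>(1)[of "Suc k"] Suc by (simp add: y'_def)
    next
      case False
      then have "d = Suc k" using that Suc by simp
      then show ?thesis using \<eta>(2)[of k] R(1) Suc by (simp add: y'_def)
    qed
  qed
  moreover have "(-1) ^ (Suc d + i) * poly (herm (Suc d)) (y' i) > 0" if "i \<le> Suc d" for i
  proof (cases i)
    case 0
    then show ?thesis using L(2) by (simp add: y'_def del: herm.simps)
  next
    case (Suc k)
    then show ?thesis
      using \<eta>(3)[of k] R(2) that by (cases "k < d") (auto simp: y'_def le_antisym not_less simp del: herm.simps)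
  qed
  ultimately show ?case unfolding alternates_def by blast
qed

text \<open>The intermediate value theorem gives \<open>d\<close> distinct real roots, and the
  degree leaves no room for further complex ones.\<close>

lemma alternates_imp_hyperbolic:
  assumes alt: "alternates d p y" and deg: "degree p \<le> d"
  shows "hyperbolic p"
proof -
  have y: "\<And>i. i < d \<Longrightarrow> y i < y (Suc i)" "\<And>i. i \<le> d \<Longrightarrow> (-1) ^ (d + i) * poly p (y i) > 0"
    using alt by (auto simp: alternates_def)
  have "\<exists>\<xi>. y i < \<xi> \<and> \<xi> < y (Suc i) \<and> poly p \<xi> = 0" if "i < d" for i
  proof -
    have "poly p (y i) * poly p (y (Suc i)) < 0"
    proof -
      have "(-1) ^ (d + i) * poly p (y i) * ((-1) ^ (d + Suc i) * poly p (y (Suc i))) > 0"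
        by (rule mult_pos_pos[OF y(2) y(2)]) (use that in auto)
      also have "(-1) ^ (d + i) * poly p (y i) * ((-1) ^ (d + Suc i) * poly p (y (Suc i))) =
         - (((-1) ^ (d + i)) * ((-1) ^ (d + i))) * (poly p (y i) * poly p (y (Suc i)))"
        by (simp add: mult_ac)
      also have "(-1) ^ (d + i) * (-1) ^ (d + i) = (1 :: real)"
        by (metis left_minus_one_mult_self mult.right_neutral)
      finally show ?thesis by simp
    qed
    then show ?thesis using poly_IVT[OF y(1)[OF that]] by blast
  qed
  then obtain \<xi> where \<xi>: "\<And>i. i < d \<Longrightarrow> y i < \<xi> i" "\<And>i. i < d \<Longrightarrow> \<xi> i < y (Suc i)" "\<And>i. i < d \<Longrightarrow> poly p (\<xi> i) = 0"
    by metis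
  have mono: "\<xi> i < \<xi> k" if "i < k" "k < d" for i k
    using that
  proof (induction k)
    case (Suc k)
    have "\<xi> k < \<xi> (Suc k)" using \<xi>(2)[of k] \<xi>(1)[of "Suc k"] Suc.prems by simp
    then show ?case using Suc by (cases "i = k") auto
  qed simp
  have inj: "inj_on \<xi> {..<d}"
    by (intro inj_onI) (metis lessThan_iff linorder_neqE_nat mono order_less_irrefl)
  let ?Z = "{z::complex. poly (cpoly p) z = 0}"
  have "poly p (y 0) \<noteq> 0" using y(2)[of 0] by auto
  then have nz: "cpoly p \<noteq> 0" by (auto simp: map_poly_eq_0_iff)
  have "card ?Z \<le> degree (cpoly p)" by (rule card_poly_roots_bound[OF nz])
  also have "\<dots> \<le> d" using deg by (subst degree_map_poly) auto
  also have "d = card ((\<lambda>i. complex_of_real (\<xi> i)) ` {..<d})"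
    using inj by (subst card_image) (auto simp: inj_on_def)
  finally have "card ?Z \<le> card ((\<lambda>i. complex_of_real (\<xi> i)) ` {..<d})" .
  moreover have "(\<lambda>i. complex_of_real (\<xi> i)) ` {..<d} \<subseteq> ?Z"
    using \<xi>(3) by (auto simp: poly_altdef degree_map_poly coeff_map_poly simp flip: of_real_power of_real_mult of_real_sum)
  ultimately have "?Z = (\<lambda>i. complex_of_real (\<xi> i)) ` {..<d}"
    using poly_roots_finite[OF nz] by (intro card_seteq[symmetric]) auto
  then have "?Z \<subseteq> \<real>" by auto
  then show ?thesis unfolding hyperbolic_def by auto
qed

lemma alternates_eventually:
  assumes "alternates d p y" "\<And>t. (\<lambda>i. poly (P i) t) \<longlonglongrightarrow> poly p t"
  shows "\<forall>\<^sub>F i in sequentially. alternates d (P i) y"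
proof -
  have "\<forall>\<^sub>F i in sequentially. \<forall>k\<in>{..d}. (-1) ^ (d + k) * poly (P i) (y k) > 0"
  proof (rule eventually_ball_finite)
    show "\<forall>k\<in>{..d}. \<forall>\<^sub>F i in sequentially. (-1) ^ (d + k) * poly (P i) (y k) > 0"
    proof
      fix k assume "k \<in> {..d}"
      then have "(-1) ^ (d + k) * poly p (y k) > 0" using assms(1) by (simp add: alternates_def)
      then show "\<forall>\<^sub>F i in sequentially. (-1) ^ (d + k) * poly (P i) (y k) > 0"
        by (rule order_tendstoD(1)[OF tendsto_mult_left[OF assms(2)]])
    qed
  qed simp
  then show ?thesis
    by eventually_elim (use assms(1) in \<open>auto simp: alternates_def\<close>)
qed

section \<open>Limits of the Jensen polynomials\<close>

text \<open>With \<open>E\<close> the shift this is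
  \<open>t * E - c * (E - 1) = c * (1 + (t / c - 1) * E)\<close>. For
  \<open>c = sqrt 2 * \<sigma>\<close> the \<open>d\<close>-th power of the second form is the
  normalized Jensen polynomial at \<open>t\<close>, before division by the probability; the first
  form has a limit.\<close>

definition jensen_step :: "real \<Rightarrow> real \<Rightarrow> (int \<Rightarrow> real) \<Rightarrow> int \<Rightarrow> real" where
  "jensen_step c t u k = t * u (k + 1) - c * fdiff u k"

lemma funpow_jensen_step:
  assumes "c \<noteq> 0"
  shows "(jensen_step c t ^^ d) u k = c ^ d * (\<Sum>j\<le>d. real (d choose j) * (t / c - 1) ^ j * u (k + int j))"
proof (induction d arbitrary: k)
  case (Suc d)
  define q where "q = t / c - 1"
  define S where "S = (\<lambda>k. \<Sum>j\<le>d. real (d choose j) * q ^ j * u (k + int j))"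
  have t: "t = c * (q + 1)" using assms by (simp add: q_def)
  have IH: "(jensen_step c t ^^ d) u k = c ^ d * S k" for k using Suc by (simp add: q_def S_def)
  have "(jensen_step c t ^^ Suc d) u k = jensen_step c t (\<lambda>k. c ^ d * S k) k"
    by (simp add: IH[abs_def])
  also have "\<dots> = c ^ Suc d * (S k + q * S (k + 1))"
    unfolding t by (simp add: jensen_step_def fdiff_def algebra_simps)
  also have "S k + q * S (k + 1) = (\<Sum>j\<le>Suc d. real (Suc d choose j) * q ^ j * u (k + int j))"
  proof -
    have "S k = u k + (\<Sum>j\<le>d. real (d choose Suc j) * q ^ Suc j * u (k + int (Suc j)))"
    proof -
      have "S k = (\<Sum>j\<le>Suc d. real (d choose j) * q ^ j * u (k + int j))"
        by (simp add: S_def binomial_eq_0)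
      then show ?thesis by (simp only: sum.atMost_Suc_shift) simp
    qed
    moreover have "q * S (k + 1) = (\<Sum>j\<le>d. real (d choose j) * q ^ Suc j * u (k + int (Suc j)))"
      by (simp add: S_def sum_distrib_left mult_ac add_ac)
    moreover have "(\<Sum>j\<le>Suc d. real (Suc d choose j) * q ^ j * u (k + int j)) =
       u k + (\<Sum>j\<le>d. real (Suc d choose Suc j) * q ^ Suc j * u (k + int (Suc j)))"
      by (simp only: sum.atMost_Suc_shift) simp
    ultimately show ?thesis by (simp add: distrib_right sum.distrib)
  qed
  finally show ?case by (simp only: q_def)
qed simp

lemma poly_normalized_jensen:
  assumes "gauss_sd a b > 0"
  shows "poly (normalized_jensen d m a b) t =
    (jensen_step (sqrt 2 * gauss_sd a b) t ^^ d) (gauss_prob a b) m / gauss_prob a b m"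
proof -
  let ?c = "sqrt 2 * gauss_sd a b"
  have c: "?c \<noteq> 0" using assms by simp
  have "poly (normalized_jensen d m a b) t = ?c ^ d / gauss_prob a b m *
    (\<Sum>j=0..d. real (d choose j) * gauss_prob a b (m + int j) * (t / ?c - 1) ^ j)"
    by (simp add: normalized_jensen_def jensen_poly_def poly_pcompose poly_sum poly_monom gauss_delta_def
      power_one_over algebra_simps)
  then show ?thesis unfolding funpow_jensen_step[OF c]
    by (simp add: atMost_atLeast0 mult_ac)
qed

lemma degree_normalized_jensen: "degree (normalized_jensen d m a b) \<le> d"
proof -
  have "degree (jensen_poly d m u) \<le> d" for u
    unfolding jensen_poly_def by (intro degree_sum_le) (auto intro: order.trans[OF degree_monom_le])
  then have "degree (pcompose (jensen_poly d m u) [:-1, gauss_delta a b:]) \<le> d * 1" for u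
    by (intro order.trans[OF degree_pcompose_le] mult_le_mono) auto
  then show ?thesis unfolding normalized_jensen_def
    by (intro order.trans[OF degree_smult_le]) simp
qed

lemma jet_limit_jensen_step:
  assumes "jet_limit \<sigma> m u F"
  shows "jet_limit \<sigma> m (\<lambda>i. jensen_step (sqrt 2 * \<sigma> i) t (u i)) (fps_const t * F - fps_const (sqrt 2) * fps_deriv F)"
proof -
  have "jet_limit \<sigma> m (\<lambda>i k. t * u i (k + 1) + (- sqrt 2) * (\<sigma> i * fdiff (u i) k))
     (fps_const t * F + fps_const (- sqrt 2) * fps_deriv F)"
    by (intro jet_limit_add jet_limit_cmult jet_limit_shift jet_limit_diff assms)
  also have "(\<lambda>i k. t * u i (k + 1) + (- sqrt 2) * (\<sigma> i * fdiff (u i) k)) = (\<lambda>i. jensen_step (sqrt 2 * \<sigma> i) t (u i))"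
    by (simp add: fun_eq_iff jensen_step_def)
  finally show ?thesis by (simp flip: fps_const_neg)
qed

text \<open>The limit operator sends \<open>G\<close> to \<open>t * G - sqrt 2 * G'\<close>. On
  \<open>P * F\<close> with \<open>F' = - (x + X) * F\<close> it replaces \<open>P\<close> by
  \<open>q * P - sqrt 2 * P'\<close>, where \<open>q = t + sqrt 2 * (x + X)\<close>. If
  \<open>P\<close> is a polynomial in \<open>q\<close>, the chain rule adds another
  \<open>sqrt 2\<close>, whence the 2 in \<open>herm\<close>.\<close>

lemma jet_limit_funpow_jensen_step:
  assumes "jet_limit \<sigma> m u F" "gauss_ode 1 x F"
  shows "jet_limit \<sigma> m (\<lambda>i. (jensen_step (sqrt 2 * \<sigma> i) t ^^ d) (u i))
    (fps_of_poly (pcompose (herm d) [:t + sqrt 2 * x, sqrt 2:]) * F)"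
proof (induction d)
  case 0
  then show ?case using assms by (simp add: pcompose_1)
next
  case (Suc d)
  define q where "q = [:t + sqrt 2 * x, sqrt 2:]"
  define P where "P = pcompose (herm d) q"
  have "fps_const t * (fps_of_poly P * F) - fps_const (sqrt 2) * fps_deriv (fps_of_poly P * F)
     = ((fps_const t + fps_const (sqrt 2) * (fps_const x + fps_X)) * fps_of_poly P
         - fps_const (sqrt 2) * fps_deriv (fps_of_poly P)) * F"
  proof -
    have "t * (Q * F) - s * fps_deriv (Q * F) = ((t + s * Z) * Q - s * fps_deriv Q) * F"
      if "fps_deriv F = - (Z * F)" for t s Z Q :: "real fps"
      by (simp add: that algebra_simps)
    moreover have "fps_deriv F = - ((fps_const x + fps_X) * F)"
      using assms(2) by (simp add: gauss_ode_def)
    ultimately show ?thesis by blast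
  qed
  also have "fps_const t + fps_const (sqrt 2) * (fps_const x + fps_X) = fps_of_poly q"
    by (simp add: q_def fps_of_poly_pCons distrib_left flip: fps_const_add fps_const_mult)
  also have "fps_of_poly q * fps_of_poly P - fps_const (sqrt 2) * fps_deriv (fps_of_poly P) =
      fps_of_poly (q * P - smult (sqrt 2) (pderiv P))"
    by (simp add: fps_of_poly_diff fps_of_poly_mult fps_of_poly_smult fps_of_poly_pderiv)
  also have "q * P - smult (sqrt 2) (pderiv P) = pcompose (herm (Suc d)) q"
    by (simp add: P_def pderiv_pcompose pcompose_diff pcompose_mult pcompose_smult pcompose_pCons)
      (simp add: q_def pderiv_pCons)
  finally show ?case
    using jet_limit_jensen_step[OF Suc, of t] by (simp add: q_def P_def)
qed

section \<open>The Taylor series of the normal density and the limits along a sequence\<close>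

definition gauss_fps :: "real \<Rightarrow> real fps" where
  "gauss_fps x = Abs_fps (\<lambda>j. Re (gauss_jet j x) / fact j)"

lemma gauss_fps_0_pos: "fps_nth (gauss_fps x) 0 > 0"
  by (simp add: gauss_fps_def gauss_jet_0)

lemma gauss_ode_gauss_fps: "gauss_ode 1 x (gauss_fps x)"
  unfolding gauss_ode_def
proof (rule fps_ext)
  fix j
  have "fps_nth (fps_deriv (gauss_fps x)) j = Re (gauss_jet (Suc j) x) / fact j"
    by (simp add: gauss_fps_def fps_deriv_nth flip: Suc_eq_plus1 del: of_nat_Suc)
  also have "\<dots> = - (x * (Re (gauss_jet j x) / fact j)) - real j * Re (gauss_jet (j - 1) x) / fact j"
    by (simp add: gauss_jet_Suc diff_divide_distrib)
  also have "real j * Re (gauss_jet (j - 1) x) / fact j = (if j = 0 then 0 else Re (gauss_jet (j - 1) x) / fact (j - 1))"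
    by (cases j) auto
  finally show "fps_nth (fps_deriv (gauss_fps x)) j =
      fps_nth (- (fps_const 1 * ((fps_const x + fps_X) * gauss_fps x))) j"
    by (simp add: gauss_fps_def distrib_right)
qed

context balanced_sequence
begin

text \<open>An offset \<open>h\<close> moves the normalized point by \<open>h / sd i\<close>, which
  tends to 0, so \<open>local_limit\<close> applies at \<open>m i + h\<close> with the same
  \<open>x\<close>.\<close>

lemma jet_limit_gauss_prob:
  assumes x: "(\<lambda>i. (real_of_int (m i) - gauss_mean (a i) (b i)) / sd i) \<longlonglongrightarrow> x"
  shows "jet_limit sd m (\<lambda>i k. sd i * gauss_prob (a i) (b i) k) (gauss_fps x)"
  unfolding jet_limit_def diff_limit_def
proof (intro allI)
  fix j h
  have "(\<lambda>i. (real_of_int (m i) - gauss_mean (a i) (b i)) / sd i + real_of_int h / sd i) \<longlonglongrightarrow> x + 0"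
    by (intro tendsto_add x tendsto_divide_0[OF tendsto_const] filterlim_at_top_imp_at_infinity sd_top)
  then have "(\<lambda>i. (real_of_int (m i + h) - gauss_mean (a i) (b i)) / sd i) \<longlonglongrightarrow> x"
    by (simp add: add_divide_distrib[symmetric] algebra_simps)
  from tendsto_Re[OF local_limit[OF this, of j]]
  have "(\<lambda>i. sd i ^ Suc j * (fdiff ^^ j) (gauss_prob (a i) (b i)) (m i + h)) \<longlonglongrightarrow> Re (gauss_jet j x)" by simp
  then show "(\<lambda>i. sd i ^ j * (fdiff ^^ j) (\<lambda>k. sd i * gauss_prob (a i) (b i) k) (m i + h)) \<longlonglongrightarrow>
      fps_nth ((fps_deriv ^^ j) (gauss_fps x)) 0"
    unfolding funpow_fdiff_cmult funpow_fps_deriv_nth_0 by (simp add: gauss_fps_def mult_ac)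
qed

text \<open>In the quotient of constant terms \<open>gauss_fps x\<close> cancels, which leaves
  \<open>herm d\<close> at \<open>t + sqrt 2 * x\<close>; its sign pattern passes to the polynomials
  of the sequence.\<close>

lemma eventually_hyperbolic:
  assumes x: "(\<lambda>i. (real_of_int (m i) - gauss_mean (a i) (b i)) / sd i) \<longlonglongrightarrow> x"
  shows "\<forall>\<^sub>F i in sequentially. hyperbolic (normalized_jensen d (m i) (a i) (b i))"
proof -
  let ?u = "\<lambda>i k. sd i * gauss_prob (a i) (b i) k"
  note jet = jet_limit_gauss_prob[OF x]
  have lim: "(\<lambda>i. poly (normalized_jensen d (m i) (a i) (b i)) t) \<longlonglongrightarrow> poly (pcompose (herm d) [:sqrt 2 * x, 1:]) t" for t
  proof -
    have "(\<lambda>i. (jensen_step (sqrt 2 * sd i) t ^^ d) (?u i) (m i) / ?u i (m i)) \<longlonglongrightarrow>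
       fps_nth (fps_of_poly (pcompose (herm d) [:t + sqrt 2 * x, sqrt 2:]) * gauss_fps x) 0 / fps_nth (gauss_fps x) 0"
      using gauss_fps_0_pos[of x]
      by (intro tendsto_divide jet_limitD[OF jet_limit_funpow_jensen_step[OF jet gauss_ode_gauss_fps]]
          jet_limitD[OF jet]) auto
    also have "(\<lambda>i. (jensen_step (sqrt 2 * sd i) t ^^ d) (?u i) (m i) / ?u i (m i)) =
        (\<lambda>i. poly (normalized_jensen d (m i) (a i) (b i)) t)"
    proof
      fix i
      have c: "sqrt 2 * sd i \<noteq> 0" using sd_pos[of i] by simp
      have "(jensen_step (sqrt 2 * sd i) t ^^ d) (?u i) (m i) =
          sd i * (jensen_step (sqrt 2 * sd i) t ^^ d) (gauss_prob (a i) (b i)) (m i)"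
        unfolding funpow_jensen_step[OF c] by (simp add: sum_distrib_left mult_ac)
      then show "(jensen_step (sqrt 2 * sd i) t ^^ d) (?u i) (m i) / ?u i (m i) =
          poly (normalized_jensen d (m i) (a i) (b i)) t"
        using sd_pos[of i] poly_normalized_jensen[of "a i" "b i" d "m i" t] by (simp add: sd_def)
    qed
    also have "fps_nth (fps_of_poly (pcompose (herm d) [:t + sqrt 2 * x, sqrt 2:]) * gauss_fps x) 0 / fps_nth (gauss_fps x) 0
        = poly (pcompose (herm d) [:sqrt 2 * x, 1:]) t"
      using gauss_fps_0_pos[of x] by (simp add: poly_0_coeff_0[symmetric] poly_pcompose add.commute)
    finally show ?thesis .
  qed
  obtain y where y: "alternates d (herm d) y" using herm_alternates by blast
  then have "alternates d (pcompose (herm d) [:sqrt 2 * x, 1:]) (\<lambda>i. y i - sqrt 2 * x)"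
    by (simp add: alternates_def poly_pcompose)
  from alternates_eventually[OF this lim] show ?thesis
    by eventually_elim (rule alternates_imp_hyperbolic[OF _ degree_normalized_jensen])
qed

lemma eventually_L_op_pos:
  assumes x: "(\<lambda>i. (real_of_int (m i) - gauss_mean (a i) (b i)) / sd i) \<longlonglongrightarrow> x"
  shows "\<forall>\<^sub>F i in sequentially. (L_op (a i * b i) ^^ r) (gauss_coeff (a i) (b i)) (m i) > 0"
proof -
  have "(\<lambda>i k. sd i * gauss_prob (a i) (b i) k) = (\<lambda>i k. (sd i / B i) * gauss_coeff (a i) (b i) k)"
    by (simp add: fun_eq_iff gauss_prob_def B_def)
  with jet_limit_gauss_prob[OF x]
  have "jet_limit sd m (\<lambda>i k. (sd i / B i) * gauss_coeff (a i) (b i) k) (gauss_fps x)" by simp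
  from jet_limit_funpow_turan[OF this gauss_ode_gauss_fps gauss_fps_0_pos, of r] sd_pos B_pos
  obtain s \<alpha> G where G: "\<And>i. s i > 0" "jet_limit sd m (\<lambda>i k. s i * (turan ^^ r) (gauss_coeff (a i) (b i)) k) G"
    "fps_nth G 0 > 0" by auto
  have "\<forall>\<^sub>F i in sequentially. s i * (turan ^^ r) (gauss_coeff (a i) (b i)) (m i) > 0"
    by (rule order_tendstoD(1)[OF jet_limitD[OF G(2)] G(3)])
  then show ?thesis
  proof eventually_elim
    case (elim i)
    have "(L_op (a i * b i) ^^ r) (gauss_coeff (a i) (b i)) = (turan ^^ r) (gauss_coeff (a i) (b i))"
      by (rule funpow_L_op_eq_turan) (auto simp: gauss_coeff_def)
    then show ?case using elim G(1)[of i] by (simp add: zero_less_mult_iff)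
  qed
qed

end

section \<open>From sequences to a uniform threshold\<close>

theorem corollary2:
  fixes d :: nat and lam :: real
  assumes "d \<ge> 1" and "0 < lam" and "lam < 1"
  shows "\<forall>C::real. C > 0 \<longrightarrow> (\<exists>N::nat. N > 0 \<and>
    (\<forall>a b :: nat. a \<ge> N \<longrightarrow> b \<ge> N \<longrightarrow>
       real a / (real a + real b) \<in> {lam - 1 / real N <..< lam + 1 / real N} \<longrightarrow>
       (\<forall>m \<in> gauss_window C a b. hyperbolic (normalized_jensen d m a b)) \<and>
       (\<forall>r::nat. 1 \<le> r \<longrightarrow> r \<le> d \<longrightarrow>
          (\<forall>k \<in> gauss_window C a b. (L_op (a * b) ^^ r) (gauss_coeff a b) k \<ge> 0))))"
proof (intro allI impI, rule ccontr)
  fix C :: real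
  define good where "good = (\<lambda>a b m. hyperbolic (normalized_jensen d m a b) \<and>
    (\<forall>r\<in>{1..d}. (L_op (a * b) ^^ r) (gauss_coeff a b) m \<ge> 0))"
  assume "C > 0" and contra: "\<not> (\<exists>N::nat. N > 0 \<and>
    (\<forall>a b :: nat. a \<ge> N \<longrightarrow> b \<ge> N \<longrightarrow>
       real a / (real a + real b) \<in> {lam - 1 / real N <..< lam + 1 / real N} \<longrightarrow>
       (\<forall>m \<in> gauss_window C a b. hyperbolic (normalized_jensen d m a b)) \<and>
       (\<forall>r::nat. 1 \<le> r \<longrightarrow> r \<le> d \<longrightarrow>
          (\<forall>k \<in> gauss_window C a b. (L_op (a * b) ^^ r) (gauss_coeff a b) k \<ge> 0))))"
  have bad: "\<exists>a b m. a \<ge> N \<and> b \<ge> N \<and> \<bar>real a / (real a + real b) - lam\<bar> < 1 / real N \<and>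
      m \<in> gauss_window C a b \<and> \<not> good a b m" if "N > 0" for N :: nat
  proof (rule ccontr)
    assume neg: "\<not> ?thesis"
    have "good a b m" if "a \<ge> N" "b \<ge> N" "real a / (real a + real b) \<in> {lam - 1 / real N <..< lam + 1 / real N}"
      "m \<in> gauss_window C a b" for a b m
    proof -
      have "\<bar>real a / (real a + real b) - lam\<bar> < 1 / real N" using that(3) unfolding greaterThanLessThan_iff by linarith
      with neg that show ?thesis by blast
    qed
    then have "\<forall>a b :: nat. a \<ge> N \<longrightarrow> b \<ge> N \<longrightarrow>
       real a / (real a + real b) \<in> {lam - 1 / real N <..< lam + 1 / real N} \<longrightarrow>
       (\<forall>m \<in> gauss_window C a b. hyperbolic (normalized_jensen d m a b)) \<and>
       (\<forall>r::nat. 1 \<le> r \<longrightarrow> r \<le> d \<longrightarrow>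
          (\<forall>k \<in> gauss_window C a b. (L_op (a * b) ^^ r) (gauss_coeff a b) k \<ge> 0))"
      unfolding good_def by (meson atLeastAtMost_iff)
    with that contra show False by blast
  qed
  \<comment> \<open>Ratios \<open>q\<close> within \<open>e\<close> of \<open>lam\<close> satisfy
    \<open>e \<le> q\<close> and \<open>e \<le> 1 - q\<close>, so
    \<open>q * (1 - q) \<ge> e\<^sup>2\<close>, the value given to \<open>l0\<close>.\<close>
  define e where "e = min lam (1 - lam) / 2"
  have e: "e > 0" using assms by (simp add: e_def)
  \<comment> \<open>The sequence starts at \<open>N0\<close> because the locale asks for the balance
    at every index.\<close>
  obtain N0 :: nat where N0: "N0 > 0" "1 / real N0 < e"
    using reals_Archimedean[OF e] by (auto simp: inverse_eq_divide intro: that[of "Suc _"])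
  have "\<forall>i. \<exists>a b m. a \<ge> N0 + i \<and> b \<ge> N0 + i \<and> \<bar>real a / (real a + real b) - lam\<bar> < 1 / real (N0 + i) \<and>
      m \<in> gauss_window C a b \<and> \<not> good a b m"
    using N0(1) by (intro allI bad) simp
  then obtain a b m where abm: "\<And>i. a i \<ge> N0 + i" "\<And>i. b i \<ge> N0 + i"
    "\<And>i. \<bar>real (a i) / (real (a i) + real (b i)) - lam\<bar> < 1 / real (N0 + i)"
    "\<And>i. m i \<in> gauss_window C (a i) (b i)" "\<And>i. \<not> good (a i) (b i) (m i)"
    by metis
  have pos: "a i > 0" "b i > 0" for i using abm(1,2)[of i] N0(1) by auto
  define z where "z = (\<lambda>i. (real_of_int (m i) - gauss_mean (a i) (b i)) / gauss_sd (a i) (b i))"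
  have "z i \<in> {-C..C}" for i
  proof -
    have "\<bar>z i\<bar> \<le> C"
      using abm(4)[of i] gauss_sd_pos[OF pos[of i]] by (simp add: z_def gauss_window_def pos_divide_le_eq)
    then show ?thesis by (auto simp: abs_le_iff)
  qed
  then obtain x s where s: "strict_mono (s :: nat \<Rightarrow> nat)" "(z \<circ> s) \<longlonglongrightarrow> x"
    using compact_Icc[of "-C" C] unfolding compact_def by metis
  interpret balanced_sequence "a \<circ> s" "b \<circ> s" "e\<^sup>2"
  proof
    fix i
    let ?a = "a (s i)" and ?b = "b (s i)"
    define q where "q = real ?a / (real ?a + real ?b)"
    have "1 / real (N0 + s i) \<le> 1 / real N0" using N0(1) by (intro divide_left_mono) auto
    then have "\<bar>q - lam\<bar> < e" using abm(3)[of "s i"] N0(2) by (simp add: q_def)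
    moreover have "2 * e \<le> lam" "2 * e \<le> 1 - lam" by (auto simp: e_def)
    ultimately have q: "e \<le> q" "e \<le> 1 - q" by linarith+
    have "e\<^sup>2 \<le> q * (1 - q)" unfolding power2_eq_square using q e by (intro mult_mono) auto
    also have "1 - q = real ?b / (real ?a + real ?b)"
      using pos[of "s i"] by (simp add: q_def field_simps)
    finally show "e\<^sup>2 \<le> real ((a \<circ> s) i) * real ((b \<circ> s) i) / (real ((a \<circ> s) i) + real ((b \<circ> s) i))\<^sup>2"
      by (simp add: q_def power2_eq_square)
  next
    have "i \<le> a (s i)" for i
      using abm(1)[of "s i"] seq_suble[OF s(1), of i] by simp
    then show "filterlim (a \<circ> s) at_top sequentially"
      by (intro filterlim_at_top_mono[OF filterlim_ident]) auto
  qed (use pos e in auto)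
  have x: "(\<lambda>i. (real_of_int ((m \<circ> s) i) - gauss_mean ((a \<circ> s) i) ((b \<circ> s) i)) / sd i) \<longlonglongrightarrow> x"
    using s(2) unfolding sd_def by (simp add: z_def o_def)
  have "\<forall>\<^sub>F i in sequentially. \<forall>r\<in>{1..d}. (L_op (a (s i) * b (s i)) ^^ r) (gauss_coeff (a (s i)) (b (s i))) (m (s i)) > 0"
    using eventually_L_op_pos[OF x] by (intro eventually_ball_finite) auto
  moreover have "\<forall>\<^sub>F i in sequentially. hyperbolic (normalized_jensen d (m (s i)) (a (s i)) (b (s i)))"
    using eventually_hyperbolic[OF x] by simp
  ultimately have "\<forall>\<^sub>F i in sequentially. good (a (s i)) (b (s i)) (m (s i))"
    by eventually_elim (auto simp: good_def less_imp_le)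
  then show False using abm(5) by (simp add: eventually_const_iff)
qed

end
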